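(* Let $\alpha\in\mathbb{C}$, and consider the boundary value problem for twice differentiable functions $u:\mathbb{R}_{>0}\to\mathbb{C}$ $$ \begin{cases} \mathbf{L}_{\phi_{00}}\mathbf{D}^\times u+\alpha\,\mathbf{L}_{\phi_{00}}u=0\quad\text{on }\mathbb{R}_{>0},\\ \lim_{t\to0^+}t^{-\operatorname{Im}\alpha}u(t)=\lim_{t\to+\infty}t^{-\operatorname{Im}\alpha}u(t)=0. \end{cases} $$ If $\Xi(\alpha)\neq0$, then the only solution is $u=0$. If $\Xi(\alpha)=0$, then the solution is unique up to multiplicative constants: the solutions are exactly the functions $u=C\,u_\alpha$, where $C\in\mathbb{C}$ is a constant and $$ u_\alpha(t)=t^{-\mathrm{i}\alpha}\int_{0^+}^{t}y^{\mathrm{i}\alpha}\,\varTheta_{00}(\mathrm{i}y^2)\,\frac{\mathrm{d}y}{y},\qquad t>0. $$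
   Context: For $\tau\in\mathbb{C}$ with $\operatorname{Im}\tau>0$, let $\vartheta_{00}(\tau)=\sum_{n\in\mathbb{Z}}\mathrm{e}^{\mathrm{i}\pi n^2\tau}$ and $$\varTheta_{00}(\tau)=(\tau/\mathrm{i})^{1/4}\Big(\tau^2\vartheta_{00}''(\tau)+\tfrac32\tau\vartheta_{00}'(\tau)\Big),$$ with the branch of the power that is positive when $\tau/\mathrm{i}>0$. Then for $t>0$, $$\varTheta_{00}(\mathrm{i}t^2)=\pi t^{9/2}\sum_{n=1}^{\infty}n^2(2\pi n^2-3t^{-2})\,\mathrm{e}^{-\pi n^2t^2},$$ which is real and strictly positive for all $t>0$. Put $\phi_{00}(t)=-\log\varTheta_{00}(\mathrm{i}t^2)$ for $t>0$, which is real-valued. The differential operators are $\mathbf{D}^\times f(t)=\frac{t}{\mathrm{i}}f'(t)$ and, for a $C^1$-smooth function $\varphi$, $\mathbf{L}_\varphi f(t)=\mathbf{D}^\times f(t)+f(t)\,\mathbf{D}^\times\varphi(t)$. With $\zeta$ the Riemann zeta function, $\xi(s)=\frac12 s(s-1)\pi^{-s/2}\Gamma(s/2)\zeta(s)$ (an entire function, removable singularities being filled in), and $\Xi(x)=\xi(\frac12+\mathrm{i}x)$ for $x\in\mathbb{C}$. For $t>0$ and $w\in\mathbb{C}$, $t^{w}=\mathrm{e}^{w\log t}$ with real logarithm. *)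

theory Defs
  imports "HOL-Complex_Analysis.Complex_Analysis"
begin

definition theta00 :: "complex \<Rightarrow> complex" where
  "theta00 \<tau> = (\<Sum>\<^sub>\<infinity>n\<in>(UNIV :: int set). exp (\<i> * of_real pi * of_int n ^ 2 * \<tau>))"

(* Only used for Im \<tau> > 0. There Re (\<tau> / \<i>) > 0, so the principal power is the branch
   that is positive for \<tau> / \<i> > 0. *)
definition Theta00 :: "complex \<Rightarrow> complex" where
  "Theta00 \<tau> = (\<tau> / \<i>) powr (1/4) *
     (\<tau>\<^sup>2 * deriv (deriv theta00) \<tau> + 3/2 * \<tau> * deriv theta00 \<tau>)"

(* For t > 0 the argument of the logarithm is a positive real number, so this is minus its
   real logarithm, regarded as a complex number. *)
definition phi00 :: "real \<Rightarrow> complex" where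
  "phi00 t = - Ln (Theta00 (\<i> * of_real (t\<^sup>2)))"

definition Dtimes :: "(real \<Rightarrow> complex) \<Rightarrow> real \<Rightarrow> complex" where
  "Dtimes f t = of_real t / \<i> * vector_derivative f (at t)"

definition Lop :: "(real \<Rightarrow> complex) \<Rightarrow> (real \<Rightarrow> complex) \<Rightarrow> real \<Rightarrow> complex" where
  "Lop \<phi> f t = Dtimes f t + f t * Dtimes \<phi> t"

(* Analytic continuation of the Dirichlet series to the plane without 1. By the identity
   theorem the conditions determine the values at all s \<noteq> 1; the value at 1 is arbitrary. *)
definition riemann_zeta :: "complex \<Rightarrow> complex" where
  "riemann_zeta = (SOME f. f holomorphic_on (- {1}) \<and>
     (\<forall>s. Re s > 1 \<longrightarrow> (\<lambda>n. 1 / of_nat (Suc n) powr s) sums f s))"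

(* The singularities at 0, 1, -2, -4, ... are removable; remove_sings replaces the value at
   each point by the limit there. *)
definition riemann_xi :: "complex \<Rightarrow> complex" where
  "riemann_xi = remove_sings
     (\<lambda>s. 1/2 * s * (s - 1) * of_real pi powr (- s / 2) * Gamma (s / 2) * riemann_zeta s)"

definition riemann_Xi :: "complex \<Rightarrow> complex" where
  "riemann_Xi x = riemann_xi (1/2 + \<i> * x)"

definition twice_differentiable_pos :: "(real \<Rightarrow> complex) \<Rightarrow> bool" where
  "twice_differentiable_pos u \<longleftrightarrow>
     (\<forall>t>0. u differentiable (at t) \<and> (\<lambda>s. vector_derivative u (at s)) differentiable (at t))"

(* Functions on the positive half-line are represented by total functions whose values at
   t \<le> 0 are irrelevant: every condition only concerns t > 0. *)
definition bvp_solution :: "complex \<Rightarrow> (real \<Rightarrow> complex) \<Rightarrow> bool" where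
  "bvp_solution \<alpha> u \<longleftrightarrow>
     twice_differentiable_pos u \<and>
     (\<forall>t>0. Lop phi00 (Dtimes u) t + \<alpha> * Lop phi00 u t = 0) \<and>
     ((\<lambda>t. of_real (t powr (- Im \<alpha>)) * u t) \<longlongrightarrow> 0) (at_right 0) \<and>
     ((\<lambda>t. of_real (t powr (- Im \<alpha>)) * u t) \<longlongrightarrow> 0) at_top"

(* The Henstock-Kurzweil integral over (0, t] includes the improper integral at 0 (Hake). *)
definition u_sol :: "complex \<Rightarrow> real \<Rightarrow> complex" where
  "u_sol \<alpha> t = of_real t powr (- \<i> * \<alpha>) *
     integral {0<..t} (\<lambda>y. of_real y powr (\<i> * \<alpha>) * Theta00 (\<i> * of_real (y\<^sup>2)) / of_real y)"

end

theory Submission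
  imports Defs "HOL-Real_Asymp.Real_Asymp" "HOL-Probability.Characteristic_Functions"
begin

text \<open>
  Write \<Theta>(t) for the value of Theta00 at i t^2. Since phi00 = - log \<Theta>, the operator Lop phi00 sends f
  to \<Theta> times the Dtimes-derivative of f / \<Theta>. The differential equation therefore says that
  (Dtimes u + \<alpha> u) / \<Theta> is a constant c. With the integrating factor t^(i \<alpha>) this becomes
  (t^(i \<alpha>) u)' = i c t^(i \<alpha>) \<Theta>(t) / t, hence t^(i \<alpha>) u(t) = K + i c I(t), where I(t) is
  the integral of y^(i \<alpha>) \<Theta>(y) / y over (0, t]. The weight t^(- Im \<alpha>) in the boundary conditions
  is the absolute value of t^(i \<alpha>), so these conditions ask K + i c I(t) to vanish at both ends.
  Since I vanishes at 0, the first one is K = 0. Since I(t) tends to \<Xi>(\<alpha>) / 2 at infinity, the second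
  one is c \<Xi>(\<alpha>) = 0. So the solutions are the multiples C u_sol with C \<Xi>(\<alpha>) = 0
  (lemmas bvp_solution_imp and imp_bvp_solution).

  Two facts about \<Theta> are needed. First, it has to be positive, and it has to decay faster than every power
  of t at both ends. For t \<ge> 1 both properties are visible from the series, whose terms are then all
  positive. The range t < 1 is reduced to this one by \<Theta>(1/t) = \<Theta>(t) (Theta_axis_inversion), a
  consequence of the inversion formula of the theta function (theta_inversion), which is Poisson summation
  for Gaussians.

  Second, the Mellin transform of \<Theta> has to be identified with \<Xi>. It is an entire function because of the
  decay. In the half-plane Re s > 1 the series can be integrated term by term, and each term is a Gamma
  integral; the result is the product of a Gamma factor with the Dirichlet series of \<zeta> (theta_mellin_sums).
  This product formula yields the analytic continuation of \<zeta> in terms of the entire Mellin transform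
  (riemann_zeta_eq), and so \<xi> is that transform everywhere (riemann_xi_eq).
\<close>

section \<open>Moments of the theta series\<close>

text \<open>
  Half of the theta series with the term 0 left out, weighted by n^(2k): up to constant factors these are
  the derivatives of theta00. The index n of the sum is shifted by one.
\<close>
definition theta_moment :: "nat \<Rightarrow> complex \<Rightarrow> complex" where
  "theta_moment k \<tau> = (\<Sum>n. of_nat (Suc n) ^ (2 * k) * exp (\<i> * of_real pi * of_nat (Suc n) ^ 2 * \<tau>))"

definition real_theta_moment :: "nat \<Rightarrow> real \<Rightarrow> real" where
  "real_theta_moment k r = (\<Sum>n. real (Suc n) ^ (2 * k) * exp (- (pi * real (Suc n) ^ 2 * r)))"

lemma summable_power_times_exp:
  fixes c :: real
  assumes "c > 0"
  shows "summable (\<lambda>n. real (Suc n) ^ m * exp (- (c * real (Suc n))))"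
proof (rule summable_comparison_test_bigo)
  show "summable (\<lambda>n. norm (exp (- (c / 2)) ^ n))"
    using assms by (simp add: summable_geometric)
  have "(\<lambda>n. real (Suc n) ^ m * exp (- (c * real (Suc n)))) \<in> O(\<lambda>n. exp (- (c / 2) * real n))"
    using assms by real_asymp
  also have "(\<lambda>n. exp (- (c / 2) * real n)) = (\<lambda>n. exp (- (c / 2)) ^ n)"
    by (simp add: exp_of_nat_mult [symmetric] mult.commute)
  finally show "(\<lambda>n. real (Suc n) ^ m * exp (- (c * real (Suc n)))) \<in> O(\<lambda>n. exp (- (c / 2)) ^ n)" .
qed

lemma norm_theta_moment_term:
  "norm (of_nat (Suc n) ^ (2 * k) * exp (\<i> * of_real pi * of_nat (Suc n) ^ 2 * \<tau>))
     = real (Suc n) ^ (2 * k) * exp (- (pi * real (Suc n) ^ 2 * Im \<tau>))"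
proof -
  have "Re (\<i> * of_real pi * of_nat (Suc n) ^ 2 * \<tau>) = - (pi * real (Suc n) ^ 2 * Im \<tau>)"
    by (simp add: power2_eq_square algebra_simps)
  thus ?thesis
    by (simp add: norm_mult norm_power del: of_nat_Suc)
qed

lemma norm_theta_moment_term_le:
  assumes "0 < c" "c \<le> Im \<tau>"
  shows "norm (of_nat (Suc n) ^ (2 * k) * exp (\<i> * of_real pi * of_nat (Suc n) ^ 2 * \<tau>))
     \<le> real (Suc n) ^ (2 * k) * exp (- (pi * c * real (Suc n)))"
proof -
  have "c * real (Suc n) \<le> Im \<tau> * real (Suc n) ^ 2"
    using assms by (intro mult_mono) (auto simp: power2_eq_square algebra_simps)
  hence "pi * c * real (Suc n) \<le> pi * real (Suc n) ^ 2 * Im \<tau>"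
    by (simp add: mult_ac del: of_nat_Suc)
  thus ?thesis
    unfolding norm_theta_moment_term by (intro mult_left_mono) (auto simp del: of_nat_Suc)
qed

lemma summable_norm_theta_moment:
  assumes "Im \<tau> > 0"
  shows "summable (\<lambda>n. norm (of_nat (Suc n) ^ (2 * k) * exp (\<i> * of_real pi * of_nat (Suc n) ^ 2 * \<tau>)))"
proof (rule summable_comparison_test', rule summable_power_times_exp)
  show "0 < pi * Im \<tau>" using assms by simp
  fix n
  show "norm (norm (of_nat (Suc n) ^ (2 * k) * exp (\<i> * of_real pi * of_nat (Suc n) ^ 2 * \<tau>)))
    \<le> real (Suc n) ^ (2 * k) * exp (- (pi * Im \<tau> * real (Suc n)))"
    using norm_theta_moment_term_le[OF assms order_refl] by (simp only: real_norm_def abs_norm_cancel)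
qed

lemma theta_moment_sums:
  assumes "Im \<tau> > 0"
  shows "(\<lambda>n. of_nat (Suc n) ^ (2 * k) * exp (\<i> * of_real pi * of_nat (Suc n) ^ 2 * \<tau>)) sums theta_moment k \<tau>"
  unfolding theta_moment_def
  by (rule summable_sums, rule summable_norm_cancel, rule summable_norm_theta_moment, rule assms)

text \<open>
  Differentiating a term multiplies it by i \<pi> n^2, which raises the weight exponent by two. Near \<tau> the
  imaginary part stays above Im \<tau> / 2, and this gives a summable bound that is uniform there.
\<close>
lemma has_field_derivative_theta_moment:
  assumes "Im \<tau> > 0"
  shows "(theta_moment k has_field_derivative \<i> * of_real pi * theta_moment (Suc k) \<tau>) (at \<tau>)"
proof -
  let ?S = "{\<tau>. Im \<tau> > 0}"
  let ?f = "\<lambda>k n \<tau>. of_nat (Suc n) ^ (2 * k) * exp (\<i> * of_real pi * of_nat (Suc n) ^ 2 * \<tau>) :: complex"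
  have open_S: "open ?S" by (rule open_halfspace_Im_gt)
  have "\<exists>g g'. \<forall>x \<in> ?S. ((\<lambda>n. ?f k n x) sums g x) \<and>
      ((\<lambda>n. \<i> * of_real pi * ?f (Suc k) n x) sums g' x) \<and> (g has_field_derivative g' x) (at x)"
  proof (rule series_and_derivative_comparison_local[OF open_S])
    fix n and x :: complex assume "x \<in> ?S"
    show "(?f k n has_field_derivative \<i> * of_real pi * ?f (Suc k) n x) (at x)"
      by (auto intro!: derivative_eq_intros simp: power2_eq_square algebra_simps simp del: of_nat_Suc)
  next
    fix x :: complex assume x: "x \<in> ?S"
    let ?c = "Im x / 2"
    have "?c \<le> Im y" if "y \<in> ball x ?c" for y
      using abs_Im_le_cmod[of "x - y"] that by (auto simp: dist_norm)
    hence "\<forall>y\<in>ball x ?c \<inter> ?S. norm (?f k n y) \<le> real (Suc n) ^ (2 * k) * exp (- (pi * ?c * real (Suc n)))" for n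
      using x by (intro ballI norm_theta_moment_term_le) auto
    moreover have "summable (\<lambda>n. real (Suc n) ^ (2 * k) * exp (- (pi * ?c * real (Suc n))))"
      using x by (intro summable_power_times_exp) auto
    ultimately show "\<exists>d h. 0 < d \<and> summable h \<and>
        (\<forall>\<^sub>F n in sequentially. \<forall>y\<in>ball x d \<inter> ?S. norm (?f k n y) \<le> h n)"
      using x by (intro exI[of _ ?c] exI conjI always_eventually allI) auto
  qed
  then obtain g g' where g: "\<And>x. x \<in> ?S \<Longrightarrow> (\<lambda>n. ?f k n x) sums g x"
    and g': "\<And>x. x \<in> ?S \<Longrightarrow> (\<lambda>n. \<i> * of_real pi * ?f (Suc k) n x) sums g' x"
    and deriv: "\<And>x. x \<in> ?S \<Longrightarrow> (g has_field_derivative g' x) (at x)"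
    by blast
  have eq: "g x = theta_moment k x" if "x \<in> ?S" for x
    using sums_unique2[OF g[OF that]] theta_moment_sums[of x k] that by auto
  have "g' \<tau> = \<i> * of_real pi * theta_moment (Suc k) \<tau>"
    using assms by (intro sums_unique2[OF g'] sums_mult theta_moment_sums) auto
  moreover have "(theta_moment k has_field_derivative g' \<tau>) (at \<tau>)"
    using assms open_S eq by (intro has_field_derivative_transform_within_open[OF deriv, of \<tau> ?S]) auto
  ultimately show ?thesis by simp
qed

lemma theta00_eq_theta_moment:
  assumes "Im \<tau> > 0"
  shows "theta00 \<tau> = 1 + 2 * theta_moment 0 \<tau>"
proof -
  let ?f = "\<lambda>n::int. exp (\<i> * of_real pi * of_int n ^ 2 * \<tau>)"
  have *: "((\<lambda>n. exp (\<i> * of_real pi * of_nat (Suc n) ^ 2 * \<tau>)) has_sum theta_moment 0 \<tau>) UNIV"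
    using norm_summable_imp_has_sum[OF summable_norm_theta_moment theta_moment_sums, OF assms assms, of 0]
    by (simp only: mult_0_right power_0 mult_1)
  have pos: "(?f has_sum theta_moment 0 \<tau>) (range (\<lambda>n. int (Suc n)))"
    by (subst has_sum_reindex) (use * in \<open>auto simp: inj_on_def o_def\<close>)
  have neg: "(?f has_sum theta_moment 0 \<tau>) (range (\<lambda>n. - int (Suc n)))"
    by (subst has_sum_reindex) (use * in \<open>auto simp: inj_on_def o_def power2_eq_square algebra_simps\<close>)
  have "(?f has_sum (theta_moment 0 \<tau> + theta_moment 0 \<tau>))
      (range (\<lambda>n. int (Suc n)) \<union> range (\<lambda>n. - int (Suc n)))"
    by (intro has_sum_Un_disjoint pos neg) auto
  moreover have "(?f has_sum 1) {0}"
    by (rule has_sum_finiteI) auto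
  ultimately have "(?f has_sum (theta_moment 0 \<tau> + theta_moment 0 \<tau> + 1))
      ((range (\<lambda>n. int (Suc n)) \<union> range (\<lambda>n. - int (Suc n))) \<union> {0})"
    by (rule has_sum_Un_disjoint) auto
  also have "(range (\<lambda>n. int (Suc n)) \<union> range (\<lambda>n. - int (Suc n))) \<union> {0} = UNIV"
  proof -
    have "n \<in> (range (\<lambda>n. int (Suc n)) \<union> range (\<lambda>n. - int (Suc n))) \<union> {0}" for n
    proof (cases "n = 0")
      case False
      hence "n = int (Suc (nat (n - 1))) \<or> n = - int (Suc (nat (- n - 1)))"
        by auto
      thus ?thesis by blast
    qed auto
    thus ?thesis by blast
  qed
  finally show ?thesis
    unfolding theta00_def by (simp add: infsumI)
qed

lemma real_theta_moment_sums:
  assumes "r > 0"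
  shows "(\<lambda>n. real (Suc n) ^ (2 * k) * exp (- (pi * real (Suc n) ^ 2 * r))) sums real_theta_moment k r"
  using summable_norm_theta_moment[of "\<i> * of_real r" k] assms
  unfolding norm_theta_moment_term real_theta_moment_def by (simp add: summable_sums)

lemma theta_moment_imaginary_axis:
  assumes "r > 0"
  shows "theta_moment k (\<i> * of_real r) = of_real (real_theta_moment k r)"
proof -
  have "of_nat (Suc n) ^ (2 * k) * exp (\<i> * of_real pi * of_nat (Suc n) ^ 2 * (\<i> * of_real r))
      = complex_of_real (real (Suc n) ^ (2 * k) * exp (- (pi * real (Suc n) ^ 2 * r)))" for n
  proof -
    have "\<i> * of_real pi * of_nat (Suc n) ^ 2 * (\<i> * of_real r) = complex_of_real (- (pi * real (Suc n) ^ 2 * r))"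
      by (simp add: complex_eq_iff)
    thus ?thesis by (simp only: exp_of_real of_real_mult of_real_power of_real_of_nat_eq)
  qed
  moreover have "(\<lambda>n. complex_of_real (real (Suc n) ^ (2 * k) * exp (- (pi * real (Suc n) ^ 2 * r))))
      sums of_real (real_theta_moment k r)"
    using real_theta_moment_sums[OF assms] by (simp only: sums_of_real_iff)
  ultimately show ?thesis
    using theta_moment_sums[of "\<i> * of_real r" k] assms by (simp add: sums_iff del: of_nat_Suc)
qed

lemma has_real_derivative_real_theta_moment:
  assumes "r > 0"
  shows "(real_theta_moment k has_real_derivative - (pi * real_theta_moment (Suc k) r)) (at r)"
proof -
  have *: "((\<lambda>r. theta_moment k (\<i> * of_real r)) has_vector_derivative
      (\<i> * (\<i> * of_real pi * theta_moment (Suc k) (\<i> * of_real r)))) (at r)"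
    by (rule has_vector_derivative_eq_rhs[OF field_vector_diff_chain_at
            [where f = "\<lambda>r. \<i> * of_real r" and g = "theta_moment k", unfolded o_def]])
       (auto intro!: derivative_eq_intros has_field_derivative_theta_moment simp: assms)
  have "((\<lambda>r. Re (theta_moment k (\<i> * of_real r))) has_vector_derivative
      Re (\<i> * (\<i> * of_real pi * theta_moment (Suc k) (\<i> * of_real r)))) (at r)"
    using bounded_linear.has_vector_derivative[OF bounded_linear_Re *] by simp
  also have "Re (\<i> * (\<i> * of_real pi * theta_moment (Suc k) (\<i> * of_real r)))
      = - (pi * real_theta_moment (Suc k) r)"
    using assms by (simp add: theta_moment_imaginary_axis)
  finally have "((\<lambda>r. Re (theta_moment k (\<i> * of_real r))) has_real_derivative
      - (pi * real_theta_moment (Suc k) r)) (at r)"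
    by (simp add: has_real_derivative_iff_has_vector_derivative)
  thus ?thesis
    by (rule has_field_derivative_transform_within_open[where S = "{0<..}"])
       (use assms in \<open>auto simp: theta_moment_imaginary_axis\<close>)
qed

section \<open>Poisson summation and the inversion formula\<close>

definition fourier_char :: "int \<Rightarrow> real \<Rightarrow> complex" where
  "fourier_char k x = cis (2 * pi * of_int k * x)"

lemma fourier_char_add: "fourier_char (j + k) x = fourier_char j x * fourier_char k x"
  by (simp add: fourier_char_def cis_mult algebra_simps)

lemma fourier_char_0 [simp]: "fourier_char 0 x = 1"
  by (simp add: fourier_char_def)

lemma norm_fourier_char [simp]: "norm (fourier_char k x) = 1"
  by (simp add: fourier_char_def)

lemma continuous_on_fourier_char [continuous_intros]:
  "continuous_on A (fourier_char k)"
  unfolding fourier_char_def by (intro continuous_intros)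

lemma has_vector_derivative_fourier_char:
  "(fourier_char k has_vector_derivative (2 * pi * of_int k * \<i> * fourier_char k x)) (at x within A)"
  unfolding fourier_char_def has_vector_derivative_def
  by (auto intro!: derivative_eq_intros simp: scaleR_conv_of_real algebra_simps)

lemma fourier_char_shift: "fourier_char k (x + of_int n) = fourier_char k x"
proof -
  have "fourier_char k (x + of_int n) = fourier_char k x * cis (2 * pi * of_int (k * n))"
    by (simp add: fourier_char_def cis_mult algebra_simps)
  thus ?thesis by (simp add: cis_multiple_2pi del: of_int_mult)
qed

lemma fourier_char_half_period: "fourier_char k (1/2) = fourier_char k (-1/2)"
  using fourier_char_shift[of k "-1/2" 1] by simp

lemma integral_fourier_char:
  "integral {-1/2..1/2} (fourier_char k) = (if k = 0 then 1 else 0)"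
proof (cases "k = 0")
  case True
  hence "fourier_char k = (\<lambda>_. 1)" by auto
  thus ?thesis using True by simp
next
  case False
  have "((\<lambda>x. 2 * pi * of_int k * \<i> * fourier_char k x) has_integral
      (fourier_char k (1/2) - fourier_char k (-1/2))) {-1/2..1/2}"
    by (intro fundamental_theorem_of_calculus has_vector_derivative_fourier_char) auto
  hence "((\<lambda>x. 2 * pi * of_int k * \<i> * fourier_char k x) has_integral 0) {-1/2..1/2}"
    by (simp add: fourier_char_half_period)
  hence "integral {-1/2..1/2} (\<lambda>x. (2 * pi * of_int k * \<i>) * fourier_char k x) = 0"
    by (rule integral_unique)
  thus ?thesis using False by simp
qed

text \<open>
  Integration by parts: the bounded function g' replaces g, and integrating the character gains a factor 1/k.
\<close>
lemma fourier_coefficient_bound: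
  fixes g :: "real \<Rightarrow> complex"
  assumes deriv: "\<And>x. x \<in> {-1/2..1/2} \<Longrightarrow> (g has_vector_derivative g' x) (at x within {-1/2..1/2})"
    and cont: "continuous_on {-1/2..1/2} g'"
  shows "\<exists>K. \<forall>k. k \<noteq> 0 \<longrightarrow> norm (integral {-1/2..1/2} (\<lambda>x. g x * fourier_char k x)) \<le> K / \<bar>of_int k\<bar>"
proof -
  have cont_g: "continuous_on {-1/2..1/2} g"
    using deriv by (meson continuous_on_vector_derivative)
  obtain B where B: "\<And>x. x \<in> {-1/2..1/2} \<Longrightarrow> norm (g' x) \<le> B"
    using compact_imp_bounded[OF compact_continuous_image[OF cont compact_Icc]]
    unfolding bounded_iff by blast
  show ?thesis
  proof (rule exI[of _ "(norm (g (1/2)) + norm (g (-1/2)) + B) / (2 * pi)"], intro allI impI)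
    fix k :: int assume k: "k \<noteq> 0"
    let ?E = "fourier_char k" and ?I = "integral {-1/2..1/2} (\<lambda>x. g x * fourier_char k x)"
    let ?b = "g (1/2) * ?E (1/2) - g (-1/2) * ?E (-1/2)"
    have "((\<lambda>x. g x * (2 * pi * of_int k * \<i> * ?E x) + g' x * ?E x) has_integral ?b) {-1/2..1/2}"
      by (intro fundamental_theorem_of_calculus has_vector_derivative_mult
          has_vector_derivative_fourier_char deriv) auto
    moreover have "(\<lambda>x. g' x * ?E x) integrable_on {-1/2..1/2}"
      by (intro integrable_continuous_real continuous_intros cont)
    ultimately have "((\<lambda>x. (g x * (2 * pi * of_int k * \<i> * ?E x) + g' x * ?E x) - g' x * ?E x)
        has_integral (?b - integral {-1/2..1/2} (\<lambda>x. g' x * ?E x))) {-1/2..1/2}"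
      by (rule has_integral_diff[OF _ integrable_integral])
    hence "((\<lambda>x. (2 * pi * of_int k * \<i>) * (g x * ?E x)) has_integral
        (?b - integral {-1/2..1/2} (\<lambda>x. g' x * ?E x))) {-1/2..1/2}"
      by (rule has_integral_eq[rotated]) (simp add: algebra_simps)
    hence "(2 * pi * of_int k * \<i>) * ?I = ?b - integral {-1/2..1/2} (\<lambda>x. g' x * ?E x)"
      by (subst integral_mult_right [symmetric]) (rule integral_unique)
    moreover have "norm (integral {-1/2..1/2} (\<lambda>x. g' x * ?E x)) \<le> B * (1/2 - (-1/2))"
    proof (rule integral_bound)
      show "continuous_on {-1/2..1/2} (\<lambda>x. g' x * ?E x)"
        by (intro continuous_intros cont)
      show "norm (g' x * ?E x) \<le> B" if "x \<in> {-1/2..1/2}" for x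
        using B[OF that] by (simp add: norm_mult)
    qed auto
    moreover have "norm ?b \<le> norm (g (1/2)) + norm (g (-1/2))"
      using norm_triangle_ineq4[of "g (1/2) * ?E (1/2)" "g (-1/2) * ?E (-1/2)"] by (simp add: norm_mult)
    ultimately have "norm ((2 * pi * of_int k * \<i>) * ?I) \<le> norm (g (1/2)) + norm (g (-1/2)) + B"
      using norm_triangle_ineq4[of ?b "integral {-1/2..1/2} (\<lambda>x. g' x * ?E x)"] by simp
    hence "2 * pi * (norm ?I * \<bar>of_int k\<bar>) \<le> norm (g (1/2)) + norm (g (-1/2)) + B"
      by (simp add: norm_mult mult_ac)
    thus "norm ?I \<le> ((norm (g (1/2)) + norm (g (-1/2)) + B) / (2 * pi)) / \<bar>of_int k\<bar>"
      using k by (simp add: field_simps)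
  qed
qed

text \<open>
  Both F z - F 0 and e^(2 \<pi> i z) - 1 vanish at 0. The second zero is simple and the only one in the unit
  disc, so the quotient is holomorphic there.
\<close>
lemma holomorphic_fourier_factorization:
  assumes "F holomorphic_on ball 0 1"
  obtains g where "g holomorphic_on ball 0 1"
    "\<And>z. z \<in> ball 0 1 \<Longrightarrow> F z - F 0 = g z * (exp (2 * pi * \<i> * z) - 1)"
proof -
  define p where "p = (\<lambda>z. if z = 0 then deriv F 0 else (F z - F 0) / (z - 0))"
  let ?e = "\<lambda>z. exp (2 * pi * \<i> * z) :: complex"
  define q where "q = (\<lambda>z. if z = 0 then deriv ?e 0 else (?e z - ?e 0) / (z - 0))"
  have p: "p holomorphic_on ball 0 1"
    unfolding p_def by (rule pole_lemma_open) (use assms in auto)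
  have q: "q holomorphic_on ball 0 1"
    unfolding q_def by (rule pole_lemma_open) (auto intro!: holomorphic_intros)
  have "deriv ?e 0 = 2 * pi * \<i>"
    by (rule DERIV_imp_deriv) (auto intro!: derivative_eq_intros)
  \<comment> \<open>The value 1 is taken by the exponential only at integers z, and 0 is the only integer in the disc.\<close>
  hence q0: "q z \<noteq> 0" if "z \<in> ball 0 1" for z
  proof (cases "z = 0")
    case False
    have "?e z \<noteq> 1"
    proof
      assume "?e z = 1"
      then obtain n :: int where n: "Im (2 * pi * \<i> * z) = of_int (2 * n) * pi" "Re (2 * pi * \<i> * z) = 0"
        by (auto simp: exp_eq_1)
      hence *: "Re z = of_int n" "Im z = 0" by auto
      have "\<bar>Re z\<bar> < 1" using that abs_Re_le_cmod[of z] by simp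
      hence "n = 0" using *(1) by linarith
      thus False using * False by (simp add: complex_eq_iff)
    qed
    thus ?thesis using False by (simp add: q_def)
  qed (simp add: q_def)
  show ?thesis
  proof
    show "(\<lambda>z. p z / q z) holomorphic_on ball 0 1"
      using q0 by (intro holomorphic_intros p q) auto
    show "F z - F 0 = p z / q z * (?e z - 1)" if "z \<in> ball 0 1" for z
      using q0[OF that] by (cases "z = 0") (auto simp: p_def q_def)
  qed
qed

text \<open>
  Write F(x) = F(0) + g(x) (e(x) - 1) with e(x) = e^(2 \<pi> i x) and g smooth. Multiplication by e shifts the
  Fourier coefficients, so the k-th coefficient of F is F(0) \<delta>(k) plus a difference of two consecutive
  coefficients of g. The symmetric partial sums telescope, and the two boundary terms tend to 0.
\<close>
lemma fourier_series_tendsto_at_0: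
  assumes hol: "F holomorphic_on ball 0 1"
  shows "(\<lambda>N. \<Sum>k=-int N..int N. integral {-1/2..1/2} (\<lambda>x. F (of_real x) * fourier_char k x)) \<longlonglongrightarrow> F 0"
proof -
  obtain g where g: "g holomorphic_on ball 0 1"
    and Fg: "\<And>z. z \<in> ball 0 1 \<Longrightarrow> F z - F 0 = g z * (exp (2 * pi * \<i> * z) - 1)"
    using holomorphic_fourier_factorization[OF hol] by blast
  define G where "G k = integral {-1/2..1/2} (\<lambda>x. g (of_real x) * fourier_char k x)" for k
  have in_ball: "complex_of_real x \<in> ball 0 1" if "x \<in> {-1/2..1/2}" for x using that by auto
  have image: "complex_of_real ` {-1/2..1/2} \<subseteq> ball 0 1" using in_ball by blast
  have cont_g: "continuous_on {-1/2..1/2} (\<lambda>x. g (complex_of_real x))"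
    by (rule continuous_on_compose2[OF holomorphic_on_imp_continuous_on[OF g] _ image]) (intro continuous_intros)
  have cont_g': "continuous_on {-1/2..1/2} (\<lambda>x. deriv g (complex_of_real x))"
    by (rule continuous_on_compose2[OF holomorphic_on_imp_continuous_on[OF holomorphic_deriv[OF g open_ball]] _ image])
       (intro continuous_intros)
  have deriv_g: "((\<lambda>x. g (complex_of_real x)) has_vector_derivative deriv g (of_real x)) (at x within {-1/2..1/2})"
    if "x \<in> {-1/2..1/2}" for x
  proof -
    have "(g has_field_derivative deriv g (of_real x)) (at (of_real x))"
      using holomorphic_derivI[OF g open_ball in_ball[OF that]] .
    hence "(g \<circ> of_real has_vector_derivative (1 * deriv g (of_real x))) (at x)"
      by (intro field_vector_diff_chain_at) (auto intro!: derivative_eq_intros)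
    thus ?thesis by (simp add: o_def has_vector_derivative_at_within)
  qed
  obtain K where K: "\<And>k. k \<noteq> 0 \<Longrightarrow> norm (G k) \<le> K / \<bar>of_int k\<bar>"
    using fourier_coefficient_bound[OF deriv_g cont_g'] unfolding G_def by blast
  have coeff: "integral {-1/2..1/2} (\<lambda>x. F (of_real x) * fourier_char k x)
      = F 0 * (if k = 0 then 1 else 0) + (G (k + 1) - G k)" for k
  proof -
    have int: "(\<lambda>x. g (of_real x) * fourier_char k x) integrable_on {-1/2..1/2}" for k
      by (intro integrable_continuous_real continuous_intros cont_g)
    have "integral {-1/2..1/2} (\<lambda>x. F (of_real x) * fourier_char k x) =
        integral {-1/2..1/2} (\<lambda>x. F 0 * fourier_char k x
          + (g (of_real x) * fourier_char (k + 1) x - g (of_real x) * fourier_char k x))"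
    proof (rule integral_cong)
      fix x :: real assume x: "x \<in> {-1/2..1/2}"
      have "exp (2 * pi * \<i> * of_real x) = fourier_char 1 x"
        by (simp add: fourier_char_def cis_conv_exp mult_ac)
      with Fg[OF in_ball[OF x]] have *: "F (of_real x) = F 0 + g (of_real x) * (fourier_char 1 x - 1)"
        by (simp add: algebra_simps)
      show "F (of_real x) * fourier_char k x = F 0 * fourier_char k x
          + (g (of_real x) * fourier_char (k + 1) x - g (of_real x) * fourier_char k x)"
        unfolding * fourier_char_add by (simp add: algebra_simps)
    qed
    also have "\<dots> = F 0 * integral {-1/2..1/2} (fourier_char k) + (G (k + 1) - G k)"
      unfolding G_def
      by (subst integral_add, intro integrable_continuous_real continuous_intros, intro integrable_diff int,
          subst integral_diff[OF int int], simp)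
    finally show ?thesis unfolding integral_fourier_char .
  qed
  have partial_sum: "(\<Sum>k=-int N..int N. integral {-1/2..1/2} (\<lambda>x. F (of_real x) * fourier_char k x))
      = F 0 + (G (int N + 1) - G (- int N))" for N
  proof -
    have "(\<Sum>k=-int N..int N. F 0 * (if k = 0 then 1 else 0)) = F 0"
      by (simp add: sum.delta if_distrib cong: if_cong)
    moreover have "(\<Sum>k=-int N..int N. G (k + 1) - G k) = G (int N + 1) - G (- int N)"
    proof (induction N)
      case (Suc N)
      have "{- int (Suc N)..int (Suc N)} = insert (- int (Suc N)) (insert (int (Suc N)) {-int N..int N})"
        by auto
      thus ?case using Suc by (simp add: algebra_simps)
    qed simp
    ultimately show ?thesis unfolding coeff sum.distrib by simp
  qed
  have "(\<lambda>N. G (int N + 1)) \<longlonglongrightarrow> 0"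
  proof (rule Lim_null_comparison)
    show "\<forall>\<^sub>F N in sequentially. norm (G (int N + 1)) \<le> K / (real N + 1)"
      using K[of "int _ + 1"] by (auto intro!: always_eventually)
    show "(\<lambda>N. K / (real N + 1)) \<longlonglongrightarrow> 0" by real_asymp
  qed
  moreover have "(\<lambda>N. G (- int N)) \<longlonglongrightarrow> 0"
  proof (rule Lim_null_comparison)
    show "\<forall>\<^sub>F N in sequentially. norm (G (- int N)) \<le> K / real N"
      using eventually_gt_at_top[of 0] by eventually_elim (use K[of "- int _"] in auto)
    show "(\<lambda>N. K / real N) \<longlonglongrightarrow> 0" by real_asymp
  qed
  ultimately show ?thesis
    unfolding partial_sum by (auto intro!: tendsto_eq_intros)
qed

text \<open>
  This is the characteristic function of the standard normal distribution, rescaled by sqrt (2 \<pi> a).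
\<close>
lemma gaussian_fourier_transform:
  assumes a: "a > 0"
  shows "((\<lambda>x. of_real (exp (- (pi * a * x ^ 2))) * fourier_char k x) has_integral
            of_real (exp (- (pi * of_int k ^ 2 / a)) / sqrt a)) UNIV"
proof -
  define c where "c = sqrt (2 * pi * a)"
  have c: "c > 0" "c ^ 2 = 2 * pi * a" using a by (auto simp: c_def)
  define t where "t = 2 * pi * of_int k / c"
  let ?f = "\<lambda>x. std_normal_density x *\<^sub>R iexp (t * x)"
  have eq: "?f (0 + c * x) = (of_real (exp (- (pi * a * x ^ 2))) * fourier_char k x) /\<^sub>R sqrt (2 * pi)" for x
  proof -
    have e1: "- (c * x)\<^sup>2 / 2 = - (pi * a * x ^ 2)"
      by (simp add: power_mult_distrib c)
    have e2: "t * (c * x) = 2 * pi * of_int k * x" using c(1) by (simp add: t_def)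
    show ?thesis
      unfolding add_0 std_normal_density_def e1 e2 fourier_char_def cis_conv_exp
      by (simp add: scaleR_conv_of_real divide_inverse mult_ac)
  qed
  have "exp (- (t ^ 2) / 2) = exp (- (pi * of_int k ^ 2 / a))"
    using a by (simp add: t_def power_divide power_mult_distrib c) (simp add: power2_eq_square)
  hence "of_real (exp (- (pi * of_int k ^ 2 / a))) = char std_normal_distribution t"
    by (simp add: char_std_normal_distribution)
  also have "\<dots> = (\<integral>x. ?f x \<partial>lborel)"
    unfolding char_def by (subst integral_density) auto
  also have "\<dots> = c *\<^sub>R (\<integral>x. (of_real (exp (- (pi * a * x ^ 2))) * fourier_char k x) /\<^sub>R sqrt (2 * pi) \<partial>lborel)"
    using lborel_integral_real_affine[of c ?f 0] c(1) unfolding eq by simp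
  also have "\<dots> = of_real (sqrt a) * (\<integral>x. of_real (exp (- (pi * a * x ^ 2))) * fourier_char k x \<partial>lborel)"
  proof -
    have "c *\<^sub>R (z /\<^sub>R sqrt (2 * pi)) = of_real (sqrt a) * z" for z :: complex
    proof -
      have "c = sqrt a * sqrt (2 * pi)"
        unfolding c_def real_sqrt_mult by (rule mult.commute)
      hence "c * inverse (sqrt (2 * pi)) = sqrt a" by simp
      thus ?thesis by (simp only: scaleR_scaleR) (simp add: scaleR_conv_of_real)
    qed
    thus ?thesis by simp
  qed
  finally have "(\<integral>x. of_real (exp (- (pi * a * x ^ 2))) * fourier_char k x \<partial>lborel)
      = of_real (exp (- (pi * of_int k ^ 2 / a)) / sqrt a)"
    using a by (simp add: eq_divide_eq mult.commute)
  moreover have "integrable lborel (\<lambda>x. of_real (exp (- (pi * a * x ^ 2))) * fourier_char k x)"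
  proof -
    have "integrable lborel (\<lambda>x. normal_density 0 (1 / c) x)"
      using c by (intro integrable_normal_density) auto
    also have "normal_density 0 (1 / c) = (\<lambda>x. c / sqrt (2 * pi) * exp (- (pi * a * x ^ 2)))"
    proof
      fix x
      have "1 / sqrt (2 * pi * (1 / c)\<^sup>2) = c / sqrt (2 * pi)"
        using c(1) by (simp add: power_divide real_sqrt_divide)
      moreover have "- (x - 0)\<^sup>2 / (2 * (1 / c)\<^sup>2) = - (pi * a * x ^ 2)"
        by (simp add: power_divide c(2))
      ultimately show "normal_density 0 (1 / c) x = c / sqrt (2 * pi) * exp (- (pi * a * x ^ 2))"
        unfolding normal_density_def by simp
    qed
    finally have "integrable lborel (\<lambda>x. exp (- (pi * a * x ^ 2)))"
      using c(1) integrable_mult_left_iff[of lborel "c / sqrt (2 * pi)"] by (simp del: times_divide_eq_left)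
    moreover have "(\<lambda>x. complex_of_real (exp (- (pi * a * x ^ 2))) * fourier_char k x) \<in> borel_measurable lborel"
      unfolding fourier_char_def by (simp, intro borel_measurable_continuous_onI continuous_intros)
    ultimately show ?thesis
      by (rule Bochner_Integration.integrable_bound) (auto simp: norm_mult)
  qed
  ultimately show ?thesis
    using has_integral_integral_lborel by metis
qed

lemma integral_expanding_intervals_tendsto:
  fixes f :: "real \<Rightarrow> complex"
  assumes "(f has_integral I) UNIV"
  shows "(\<lambda>N. integral {- real N - 1/2..real N + 1/2} f) \<longlonglongrightarrow> I"
proof (rule tendstoI)
  fix e :: real assume e: "e > 0"
  then obtain B where B: "\<And>a b. ball 0 B \<subseteq> cbox a b \<Longrightarrow> norm (integral (cbox a b) f - I) < e"
    using assms unfolding has_integral_alt' by (simp only: UNIV_I if_True) blast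
  show "\<forall>\<^sub>F N in sequentially. dist (integral {- real N - 1/2..real N + 1/2} f) I < e"
    using eventually_ge_at_top[of "nat \<lceil>B\<rceil>"]
  proof eventually_elim
    case (elim N)
    hence "ball 0 B \<subseteq> cbox (- real N - 1/2) (real N + 1/2)"
      by (auto simp: dist_norm abs_le_iff nat_le_iff ceiling_le_iff)
    from B[OF this] show ?case by (simp add: dist_norm)
  qed
qed

text \<open>
  The unfolding step of Poisson summation: the translates of [-1/2, 1/2] tile a long interval.
\<close>
lemma integral_sum_translates:
  fixes f :: "real \<Rightarrow> complex"
  assumes "continuous_on UNIV f"
  shows "(\<Sum>n=-int N..int N. integral {-1/2..1/2} (\<lambda>x. f (x + of_int n)))
           = integral {- real N - 1/2..real N + 1/2} f"
proof (induction N)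
  case (Suc N)
  have int: "f integrable_on {a..b}" for a b
    using assms by (intro integrable_continuous_real) (auto intro: continuous_on_subset)
  let ?A = "\<lambda>n::int. integral {-1/2..1/2} (\<lambda>x. f (x + of_int n))"
  define A where "A = ?A"
  have shift: "A n = integral {of_int n - 1/2..of_int n + 1/2} f" for n
    unfolding A_def
    using integral_shift_real_ivl[of "of_int n - 1/2" "of_int n" "of_int n + 1/2" f] by simp
  have IH: "(\<Sum>n=-int N..int N. A n) = integral {- real N - 1/2..real N + 1/2} f"
    unfolding A_def by (rule Suc.IH)
  have "{- int (Suc N)..int (Suc N)} = insert (- int (Suc N)) (insert (int (Suc N)) {-int N..int N})"
    by auto
  hence "(\<Sum>n=-int (Suc N)..int (Suc N). A n) = A (- int (Suc N)) + ((\<Sum>n=-int N..int N. A n) + A (int (Suc N)))"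
    by simp
  also have "\<dots> = integral {- real (Suc N) - 1/2..- real N - 1/2} f
        + (integral {- real N - 1/2..real N + 1/2} f + integral {real N + 1/2..real (Suc N) + 1/2} f)"
  proof -
    have "A (- int (Suc N)) = integral {- real (Suc N) - 1/2..- real N - 1/2} f"
      unfolding shift by (rule arg_cong2[where f = "\<lambda>a b. integral {a..b} f"]) auto
    moreover have "A (int (Suc N)) = integral {real N + 1/2..real (Suc N) + 1/2} f"
      unfolding shift by (rule arg_cong2[where f = "\<lambda>a b. integral {a..b} f"]) auto
    ultimately show ?thesis using IH by (simp only:)
  qed
  also have "integral {- real N - 1/2..real N + 1/2} f + integral {real N + 1/2..real (Suc N) + 1/2} f
      = integral {- real N - 1/2..real (Suc N) + 1/2} f"
    by (intro Henstock_Kurzweil_Integration.integral_combine int) auto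
  also have "integral {- real (Suc N) - 1/2..- real N - 1/2} f + \<dots>
      = integral {- real (Suc N) - 1/2..real (Suc N) + 1/2} f"
    by (intro Henstock_Kurzweil_Integration.integral_combine int) auto
  finally show ?case unfolding A_def .
qed simp

lemma sum_symmetric_interval:
  fixes f :: "int \<Rightarrow> 'a::comm_ring_1"
  shows "(\<Sum>n=-int N..int N. f n) = f 0 + (\<Sum>n<N. f (int (Suc n)) + f (- int (Suc n)))"
proof (induction N)
  case (Suc N)
  have "{- int (Suc N)..int (Suc N)} = insert (- int (Suc N)) (insert (int (Suc N)) {-int N..int N})"
    by auto
  thus ?case using Suc by (simp add: algebra_simps)
qed simp

lemma theta_symmetric_sums_tendsto:
  assumes "r > 0"
  shows "(\<lambda>N. \<Sum>n=-int N..int N. exp (- (pi * of_int n ^ 2 * r))) \<longlonglongrightarrow> 1 + 2 * real_theta_moment 0 r"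
proof -
  have "(\<lambda>N. \<Sum>n<N. 2 * exp (- (pi * real (Suc n) ^ 2 * r))) \<longlonglongrightarrow> 2 * real_theta_moment 0 r"
    using sums_mult[OF real_theta_moment_sums[OF assms, of 0], of 2]
    by (simp add: sums_def del: of_nat_Suc)
  hence "(\<lambda>N. 1 + (\<Sum>n<N. 2 * exp (- (pi * real (Suc n) ^ 2 * r)))) \<longlonglongrightarrow> 1 + 2 * real_theta_moment 0 r"
    by (intro tendsto_intros)
  thus ?thesis
    by (simp add: sum_symmetric_interval del: of_nat_Suc)
qed

text \<open>
  The real part of z is at most 1 in absolute value, so the translate by n = \<plusminus>(m + 1) is at distance at least m
  from the imaginary axis. The estimate m \<le> m^2 turns the Gaussian decay into a geometric one.
\<close>
lemma norm_gaussian_translate_le: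
  fixes z :: complex
  assumes a: "a > 0" and z: "z \<in> ball 0 1" and n: "\<bar>of_int n\<bar> = real (Suc m)"
  shows "norm (exp (- of_real (pi * a) * (z + of_int n) ^ 2)) \<le> exp (pi * a) * exp (- (pi * a)) ^ m"
proof -
  have x: "\<bar>Re z\<bar> \<le> 1" and y: "\<bar>Im z\<bar> \<le> 1"
    using z abs_Re_le_cmod[of z] abs_Im_le_cmod[of z] by auto
  have "real m \<le> \<bar>Re z + of_int n\<bar>" using x n by linarith
  hence "real m ^ 2 \<le> (Re z + of_int n) ^ 2"
    by (metis abs_of_nat abs_le_square_iff)
  moreover have "real m \<le> real m ^ 2"
    by (cases m) (auto simp: power2_eq_square field_simps simp del: of_nat_mult)
  moreover have "Im z ^ 2 \<le> 1" using y by (simp add: abs_square_le_1)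
  ultimately have "pi * a * (Im z ^ 2 - (Re z + of_int n) ^ 2) \<le> pi * a * (1 - real m)"
    using a by (intro mult_left_mono; linarith?) auto
  moreover have "Re (- of_real (pi * a) * (z + of_int n) ^ 2) = pi * a * (Im z ^ 2 - (Re z + of_int n) ^ 2)"
    by (simp add: power2_eq_square algebra_simps)
  ultimately have "norm (exp (- of_real (pi * a) * (z + of_int n) ^ 2)) \<le> exp (pi * a * (1 - real m))"
    by (simp only: norm_exp_eq_Re exp_le_cancel_iff)
  also have "\<dots> = exp (pi * a) * exp (- (pi * a)) ^ m"
    by (simp add: exp_of_nat_mult [symmetric] exp_add [symmetric] algebra_simps)
  finally show ?thesis .
qed

text \<open>
  Poisson summation for the Gaussian e^(- \<pi> a z^2). Its periodization F is holomorphic near 0, so F(0),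
  the theta series at a, is the sum of the Fourier coefficients of F on a period interval. By unfolding,
  these coefficients are the values at the integers of the Fourier transform of the Gaussian, which form
  the theta series at 1/a divided by sqrt a.
\<close>
theorem theta_inversion:
  assumes a: "a > 0"
  shows "1 + 2 * real_theta_moment 0 a = (1 + 2 * real_theta_moment 0 (1 / a)) / sqrt a"
proof -
  define \<phi> where "\<phi> = (\<lambda>z::complex. exp (- of_real (pi * a) * z ^ 2))"
  define P where "P = (\<lambda>N z. \<Sum>n=-int N..int N. \<phi> (z + of_int n))"
  define F where "F = (\<lambda>z. \<phi> z + (\<Sum>n. \<phi> (z + of_int (int (Suc n))) + \<phi> (z + of_int (- int (Suc n)))))"
  have P_eq: "P N z = \<phi> z + (\<Sum>n<N. \<phi> (z + of_int (int (Suc n))) + \<phi> (z + of_int (- int (Suc n))))" for N z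
    unfolding P_def by (subst sum_symmetric_interval) simp
  have "uniform_limit (ball 0 1)
      (\<lambda>N z. \<Sum>n<N. \<phi> (z + of_int (int (Suc n))) + \<phi> (z + of_int (- int (Suc n))))
      (\<lambda>z. \<Sum>n. \<phi> (z + of_int (int (Suc n))) + \<phi> (z + of_int (- int (Suc n)))) sequentially"
  proof (rule Weierstrass_m_test)
    fix n and z :: complex assume z: "z \<in> ball 0 1"
    have "norm (\<phi> (z + of_int (int (Suc n)))) \<le> exp (pi * a) * exp (- (pi * a)) ^ n"
      unfolding \<phi>_def by (rule norm_gaussian_translate_le[OF a z]) simp
    moreover have "norm (\<phi> (z + of_int (- int (Suc n)))) \<le> exp (pi * a) * exp (- (pi * a)) ^ n"
      unfolding \<phi>_def by (rule norm_gaussian_translate_le[OF a z]) simp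
    ultimately show "norm (\<phi> (z + of_int (int (Suc n))) + \<phi> (z + of_int (- int (Suc n))))
        \<le> 2 * exp (pi * a) * exp (- (pi * a)) ^ n"
      by (intro order_trans[OF norm_triangle_ineq]) linarith
  next
    show "summable (\<lambda>n. 2 * exp (pi * a) * exp (- (pi * a)) ^ n)"
      using a by (intro summable_mult summable_geometric) auto
  qed
  hence unif: "uniform_limit (ball 0 1) P F sequentially"
    unfolding P_eq F_def by (intro uniform_limit_intros)
  have hol: "F holomorphic_on ball 0 1"
  proof (rule holomorphic_uniform_sequence)
    show "P N holomorphic_on ball 0 1" for N
      unfolding P_def \<phi>_def by (intro holomorphic_intros)
    fix z :: complex assume z: "z \<in> ball 0 1"
    then obtain d where d: "d > 0" "cball z d \<subseteq> ball 0 1"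
      using open_contains_cball[of "ball (0::complex) 1"] by blast
    thus "\<exists>d>0. cball z d \<subseteq> ball 0 1 \<and> uniform_limit (cball z d) P F sequentially"
      using uniform_limit_on_subset[OF unif] by blast
  qed auto
  have coeff: "integral {-1/2..1/2} (\<lambda>x. F (of_real x) * fourier_char k x)
      = of_real (exp (- (pi * of_int k ^ 2 / a)) / sqrt a)" for k
  proof -
    let ?f = "\<lambda>x. of_real (exp (- (pi * a * x ^ 2))) * fourier_char k x"
    have cont: "continuous_on UNIV ?f" by (intro continuous_intros)
    have real: "\<phi> (of_real x + of_int n) = of_real (exp (- (pi * a * (x + of_int n) ^ 2)))" for x n
      unfolding \<phi>_def by (simp flip: exp_of_real)
    have image: "complex_of_real ` {-1/2..1/2} \<subseteq> ball 0 1" by auto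
    have "uniform_limit {-1/2..1/2} (\<lambda>N x. P N (of_real x)) (\<lambda>x. F (of_real x)) sequentially"
      using uniform_limit_compose'[OF unif, of complex_of_real] image by (auto simp: o_def)
    hence "uniform_limit (cbox (-1/2) (1/2)) (\<lambda>N x. P N (of_real x) * fourier_char k x)
        (\<lambda>x. F (of_real x) * fourier_char k x) sequentially"
      by (intro uniform_lim_mult uniform_limit_const)
         (use image in \<open>auto intro!: compact_imp_bounded compact_continuous_image continuous_intros
            continuous_on_compose2[OF holomorphic_on_imp_continuous_on[OF hol]]\<close>)
    moreover have "continuous_on (cbox (-1/2) (1/2)) (\<lambda>x. P N (of_real x) * fourier_char k x)" for N
      unfolding P_def real by (intro continuous_intros)
    ultimately obtain I J where
        I: "\<And>N. ((\<lambda>x. P N (of_real x) * fourier_char k x) has_integral I N) (cbox (-1/2) (1/2))"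
      and J: "((\<lambda>x. F (of_real x) * fourier_char k x) has_integral J) (cbox (-1/2) (1/2))"
      and lim: "I \<longlonglongrightarrow> J"
      by (rule uniform_limit_integral_cbox) auto
    have "I N = integral {- real N - 1/2..real N + 1/2} ?f" for N
    proof -
      have "I N = integral {-1/2..1/2} (\<lambda>x. P N (of_real x) * fourier_char k x)"
        using integral_unique[OF I[of N]] by simp
      also have "\<dots> = integral {-1/2..1/2} (\<lambda>x. \<Sum>n=-int N..int N. ?f (x + of_int n))"
        unfolding P_def real fourier_char_shift sum_distrib_right ..
      also have "\<dots> = (\<Sum>n=-int N..int N. integral {-1/2..1/2} (\<lambda>x. ?f (x + of_int n)))"
        by (rule Henstock_Kurzweil_Integration.integral_sum)
           (auto simp: fourier_char_shift intro!: integrable_continuous_real continuous_intros)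
      also have "\<dots> = integral {- real N - 1/2..real N + 1/2} ?f"
        by (rule integral_sum_translates[OF cont])
      finally show ?thesis .
    qed
    hence "I \<longlonglongrightarrow> of_real (exp (- (pi * of_int k ^ 2 / a)) / sqrt a)"
      using integral_expanding_intervals_tendsto[OF gaussian_fourier_transform[OF a]] by presburger
    with lim have "J = of_real (exp (- (pi * of_int k ^ 2 / a)) / sqrt a)"
      using LIMSEQ_unique by blast
    thus ?thesis using integral_unique[OF J] by simp
  qed
  have "(\<lambda>N. \<Sum>k=-int N..int N. complex_of_real (exp (- (pi * of_int k ^ 2 / a)) / sqrt a)) \<longlonglongrightarrow> F 0"
    using fourier_series_tendsto_at_0[OF hol] unfolding coeff .
  moreover have "(\<lambda>N. complex_of_real ((\<Sum>k=-int N..int N. exp (- (pi * of_int k ^ 2 * (1 / a)))) / sqrt a))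
      \<longlonglongrightarrow> of_real ((1 + 2 * real_theta_moment 0 (1 / a)) / sqrt a)"
    using a by (intro tendsto_of_real tendsto_divide theta_symmetric_sums_tendsto tendsto_const) auto
  hence "(\<lambda>N. \<Sum>k=-int N..int N. complex_of_real (exp (- (pi * of_int k ^ 2 / a)) / sqrt a))
      \<longlonglongrightarrow> of_real ((1 + 2 * real_theta_moment 0 (1 / a)) / sqrt a)"
    by (simp add: sum_divide_distrib)
  ultimately have "F 0 = of_real ((1 + 2 * real_theta_moment 0 (1 / a)) / sqrt a)"
    using LIMSEQ_unique by blast
  moreover have "F 0 = of_real (1 + 2 * real_theta_moment 0 a)"
  proof (rule LIMSEQ_unique)
    show "(\<lambda>N. P N 0) \<longlonglongrightarrow> F 0"
      by (rule tendsto_uniform_limitI[OF unif]) simp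
    have "P N 0 = of_real (\<Sum>n=-int N..int N. exp (- (pi * of_int n ^ 2 * a)))" for N
      unfolding P_def \<phi>_def by (simp add: mult_ac flip: exp_of_real)
    thus "(\<lambda>N. P N 0) \<longlonglongrightarrow> of_real (1 + 2 * real_theta_moment 0 a)"
      using tendsto_of_real[OF theta_symmetric_sums_tendsto[OF a], where 'a = complex] by simp
  qed
  ultimately show ?thesis by (simp only: of_real_eq_iff)
qed

section \<open>Symmetry, positivity and decay on the imaginary axis\<close>

text \<open>
  Theta00 at i r without its branch factor r^(1/4): the two summands are \<tau>^2 \<vartheta>'' and 3/2 \<tau> \<vartheta>'
  at \<tau> = i r.
\<close>
definition theta_kernel :: "real \<Rightarrow> real" where
  "theta_kernel r = 2 * pi\<^sup>2 * r\<^sup>2 * real_theta_moment 2 r - 3 * pi * r * real_theta_moment 1 r"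

definition Theta_axis :: "real \<Rightarrow> real" where
  "Theta_axis r = r powr (1/4) * theta_kernel r"

lemma Theta00_imaginary_axis:
  assumes "r > 0"
  shows "Theta00 (\<i> * of_real r) = of_real (Theta_axis r)"
proof -
  let ?S = "{\<tau>. Im \<tau> > 0}"
  have open_S: "open ?S" by (rule open_halfspace_Im_gt)
  have d1: "(theta00 has_field_derivative 2 * (\<i> * of_real pi * theta_moment 1 \<tau>)) (at \<tau>)"
    if "\<tau> \<in> ?S" for \<tau>
  proof (rule has_field_derivative_transform_within_open[OF _ open_S that])
    show "((\<lambda>\<tau>. 1 + 2 * theta_moment 0 \<tau>) has_field_derivative 2 * (\<i> * of_real pi * theta_moment 1 \<tau>)) (at \<tau>)"
      using that has_field_derivative_theta_moment[of \<tau> 0] by (auto intro!: derivative_eq_intros)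
  qed (simp add: theta00_eq_theta_moment)
  have d2: "(deriv theta00 has_field_derivative 2 * (\<i> * of_real pi * (\<i> * of_real pi * theta_moment 2 \<tau>))) (at \<tau>)"
    if "\<tau> \<in> ?S" for \<tau>
  proof (rule has_field_derivative_transform_within_open[OF _ open_S that])
    show "((\<lambda>\<tau>. 2 * (\<i> * of_real pi * theta_moment 1 \<tau>)) has_field_derivative
        2 * (\<i> * of_real pi * (\<i> * of_real pi * theta_moment 2 \<tau>))) (at \<tau>)"
      using that has_field_derivative_theta_moment[of \<tau> 1]
      by (auto intro!: derivative_eq_intros simp: numeral_2_eq_2)
  qed (simp add: DERIV_imp_deriv[OF d1])
  have "\<i> * of_real r \<in> ?S" using assms by simp
  hence "Theta00 (\<i> * of_real r) = (of_real r) powr (1/4) *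
     ((\<i> * of_real r)\<^sup>2 * (2 * (\<i> * of_real pi * (\<i> * of_real pi * of_real (real_theta_moment 2 r))))
        + 3/2 * (\<i> * of_real r) * (2 * (\<i> * of_real pi * of_real (real_theta_moment 1 r))))"
    unfolding Theta00_def
    by (simp only: DERIV_imp_deriv[OF d1] DERIV_imp_deriv[OF d2] theta_moment_imaginary_axis[OF assms]) simp
  also have "\<dots> = of_real (r powr (1/4)) * of_real (theta_kernel r)"
  proof -
    have "complex_of_real r powr (1/4) = of_real (r powr (1/4))"
      using assms powr_of_real[of r "1/4"] by simp
    moreover have "(\<i> * a)\<^sup>2 * (2 * (\<i> * p * (\<i> * p * x))) + 3/2 * (\<i> * a) * (2 * (\<i> * p * y))
        = 2 * p\<^sup>2 * a\<^sup>2 * x - 3 * p * a * y" for a p x y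
      using i_squared by algebra
    ultimately show ?thesis by (simp only: theta_kernel_def of_real_diff of_real_mult of_real_power of_real_numeral)
  qed
  finally show ?thesis by (simp add: Theta_axis_def)
qed

text \<open>
  Used with c = 1 and c = -1: a derivative of an even function is odd, and conversely.
\<close>
lemma derivative_of_reflection_eigenfunction:
  fixes f f' :: "real \<Rightarrow> real"
  assumes "\<And>x. (f has_real_derivative f' x) (at x)" and "\<And>x. f (- x) = c * f x"
  shows "f' (- x) = - c * f' x"
proof -
  have "((\<lambda>x. f (- x)) has_real_derivative (f' (- x) * (- 1))) (at x)"
    by (rule DERIV_chain2[OF assms(1)]) (auto intro!: derivative_eq_intros)
  moreover have "((\<lambda>x. f (- x)) has_real_derivative (c * f' x)) (at x)"
    unfolding assms(2) by (auto intro!: derivative_eq_intros assms(1))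
  ultimately show ?thesis using DERIV_unique by fastforce
qed

text \<open>
  In the variable x with r = e^(2x), the inversion formula says that H(x) = r^(1/4) \<vartheta>(i r) is even. The
  operator in the definition of Theta00 is chosen so that Theta_axis(r) = (H''(x) - H(x)/4) / 4, and this
  expression is even together with H.
\<close>
lemma Theta_axis_inversion:
  assumes "r > 0"
  shows "Theta_axis (1 / r) = Theta_axis r"
proof -
  define R where "R = (\<lambda>k x. real_theta_moment k (exp (2 * x)))"
  define H where "H = (\<lambda>x. exp (x / 2) * (1 + 2 * R 0 x))"
  define H1 where "H1 = (\<lambda>x. exp (x / 2) * (1/2 * (1 + 2 * R 0 x) - 4 * pi * exp (2 * x) * R 1 x))"
  define H2 where "H2 = (\<lambda>x. exp (x / 2) *
      (1/4 * (1 + 2 * R 0 x) - 12 * pi * exp (2 * x) * R 1 x + 8 * pi\<^sup>2 * exp (2 * x) ^ 2 * R 2 x))"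
  have dR: "(R k has_real_derivative - (pi * R (Suc k) x) * (2 * exp (2 * x))) (at x)" for k x
    unfolding R_def
    by (rule DERIV_chain2[OF has_real_derivative_real_theta_moment]) (auto intro!: derivative_eq_intros)
  have dH: "(H has_real_derivative H1 x) (at x)" for x
    unfolding H_def H1_def
    by (auto intro!: derivative_eq_intros dR[THEN DERIV_cong] simp: algebra_simps)
  have dH1: "(H1 has_real_derivative H2 x) (at x)" for x
    unfolding H1_def H2_def
    by (auto intro!: derivative_eq_intros dR[THEN DERIV_cong] simp: algebra_simps power2_eq_square numeral_2_eq_2)
  have H_even: "H (- x) = 1 * H x" for x
  proof -
    have "1 + 2 * real_theta_moment 0 (exp (2 * x)) = (1 + 2 * real_theta_moment 0 (1 / exp (2 * x))) / sqrt (exp (2 * x))"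
      by (rule theta_inversion) simp
    moreover have "sqrt (exp (2 * x)) = exp x"
      by (rule real_sqrt_unique) (simp_all add: power2_eq_square flip: exp_add)
    moreover have "1 / exp (2 * x) = exp (2 * - x)" by (simp add: exp_minus field_simps)
    ultimately have "1 + 2 * real_theta_moment 0 (exp (2 * x)) = (1 + 2 * real_theta_moment 0 (exp (2 * - x))) / exp x"
      by (simp only:)
    hence "H x = exp (x / 2) / exp x * (1 + 2 * real_theta_moment 0 (exp (2 * - x)))"
      unfolding H_def R_def by simp
    also have "exp (x / 2) / exp x = exp (- x / 2)"
      by (simp flip: exp_diff)
    finally show ?thesis unfolding H_def R_def by simp
  qed
  have H2_even: "H2 (- x) = H2 x" for x
    using derivative_of_reflection_eigenfunction[OF dH1, of "- 1" x] derivative_of_reflection_eigenfunction[OF dH H_even] by simp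
  have axis: "4 * Theta_axis (exp (2 * x)) = H2 x - H x / 4" for x
  proof -
    have "exp (2 * x) powr (1/4) = exp (x / 2)" by (simp add: powr_def)
    thus ?thesis unfolding Theta_axis_def theta_kernel_def H2_def H_def R_def by (simp add: algebra_simps)
  qed
  have "r = exp (2 * (ln r / 2))" "1 / r = exp (2 * - (ln r / 2))"
    using assms by (simp_all add: exp_minus field_simps)
  thus ?thesis
    using axis[of "ln r / 2"] axis[of "- (ln r / 2)"] H_even[of "ln r / 2"] H2_even[of "ln r / 2"] by simp
qed

text \<open>
  For r \<ge> 1 every term of the series carries the factor 2 \<pi> r n^2 - 3 \<ge> 2 \<pi> - 3 > 0. The inversion
  symmetry covers r < 1, where individual terms may be negative.
\<close>
lemma Theta_axis_pos:
  assumes "r > 0"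
  shows "Theta_axis r > 0"
proof -
  have ge_1: "Theta_axis r > 0" if "r \<ge> 1" for r
  proof -
    have r: "r > 0" using that by simp
    let ?e = "\<lambda>n. exp (- (pi * real (Suc n) ^ 2 * r))"
    let ?f = "\<lambda>n. pi * r * real (Suc n) ^ 2 * (2 * pi * r * real (Suc n) ^ 2 - 3) * ?e n"
    have "(\<lambda>n. 2 * pi\<^sup>2 * r\<^sup>2 * (real (Suc n) ^ (2 * 2) * ?e n) - 3 * pi * r * (real (Suc n) ^ (2 * 1) * ?e n))
        sums theta_kernel r"
      unfolding theta_kernel_def by (intro sums_diff sums_mult real_theta_moment_sums r)
    also have "(\<lambda>n. 2 * pi\<^sup>2 * r\<^sup>2 * (real (Suc n) ^ (2 * 2) * ?e n) - 3 * pi * r * (real (Suc n) ^ (2 * 1) * ?e n)) = ?f"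
      by (simp add: fun_eq_iff algebra_simps power2_eq_square power4_eq_xxxx del: of_nat_Suc)
    finally have "?f sums theta_kernel r" .
    moreover have "?f n > 0" for n
    proof -
      have "1 \<le> r * real (Suc n) ^ 2"
        using that mult_mono[of 1 r 1 "real (Suc n) ^ 2"] by simp
      hence "2 * pi * 1 \<le> 2 * pi * (r * real (Suc n) ^ 2)" by (intro mult_left_mono) auto
      hence "2 * pi * r * real (Suc n) ^ 2 - 3 > 0" using pi_gt3 by (simp only: mult.assoc)
      thus ?thesis using r by (intro mult_pos_pos) auto
    qed
    ultimately have "theta_kernel r > 0"
      using suminf_pos[of ?f] by (simp add: sums_iff)
    thus ?thesis using r by (simp add: Theta_axis_def)
  qed
  show ?thesis
  proof (cases "r \<ge> 1")
    case False
    thus ?thesis using ge_1[of "1 / r"] assms by (simp add: Theta_axis_inversion)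
  qed (rule ge_1)
qed

text \<open>
  From (n^2 - 1) (r - 1) \<ge> 0 follows n^2 r \<ge> n^2 + r - 1, so every term is bounded by the corresponding term
  at r = 1 times a common exponential factor.
\<close>
lemma real_theta_moment_le:
  assumes "r \<ge> 1"
  shows "real_theta_moment k r \<le> exp pi * real_theta_moment k 1 * exp (- (pi * r))"
proof (rule sums_le)
  show "(\<lambda>n. real (Suc n) ^ (2 * k) * exp (- (pi * real (Suc n) ^ 2 * r))) sums real_theta_moment k r"
    using assms by (intro real_theta_moment_sums) simp
  show "(\<lambda>n. exp pi * (real (Suc n) ^ (2 * k) * exp (- (pi * real (Suc n) ^ 2 * 1))) * exp (- (pi * r)))
      sums (exp pi * real_theta_moment k 1 * exp (- (pi * r)))"
    by (intro sums_mult sums_mult2 real_theta_moment_sums) simp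
  fix n
  have "0 \<le> pi * ((real (Suc n) ^ 2 - 1) * (r - 1))"
    using assms by (intro mult_nonneg_nonneg) auto
  hence "- (pi * real (Suc n) ^ 2 * r) \<le> pi + - (pi * real (Suc n) ^ 2 * 1) + - (pi * r)"
    by (simp add: algebra_simps del: of_nat_Suc)
  hence "exp (- (pi * real (Suc n) ^ 2 * r)) \<le> exp pi * exp (- (pi * real (Suc n) ^ 2 * 1)) * exp (- (pi * r))"
    by (simp only: exp_add [symmetric] exp_le_cancel_iff)
  hence "real (Suc n) ^ (2 * k) * exp (- (pi * real (Suc n) ^ 2 * r))
      \<le> real (Suc n) ^ (2 * k) * (exp pi * exp (- (pi * real (Suc n) ^ 2 * 1)) * exp (- (pi * r)))"
    by (intro mult_left_mono) auto
  thus "real (Suc n) ^ (2 * k) * exp (- (pi * real (Suc n) ^ 2 * r))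
      \<le> exp pi * (real (Suc n) ^ (2 * k) * exp (- (pi * real (Suc n) ^ 2 * 1))) * exp (- (pi * r))"
    by (simp only: mult_ac)
qed

lemma real_theta_moment_nonneg: "r > 0 \<Longrightarrow> real_theta_moment k r \<ge> 0"
  by (rule sums_le[OF _ sums_zero real_theta_moment_sums]) auto

lemma powr_mult_exp_bounded:
  fixes c p :: real
  assumes "c > 0"
  shows "\<exists>K\<ge>0. \<forall>r\<ge>1. r powr p * exp (- (c * r)) \<le> K"
proof -
  let ?f = "\<lambda>r::real. r powr p * exp (- (c * r))"
  have "(?f \<longlongrightarrow> 0) at_top" using assms by real_asymp
  hence "eventually (\<lambda>r. ?f r < 1) at_top"
    by (rule order_tendstoD) simp
  then obtain R where R: "\<And>r. r \<ge> R \<Longrightarrow> ?f r < 1" by (auto simp: eventually_at_top_linorder)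
  have "continuous_on {1..R} ?f" by (intro continuous_intros) auto
  hence "bounded (?f ` {1..R})" by (intro compact_imp_bounded compact_continuous_image) auto
  then obtain K where K: "\<And>r. r \<in> {1..R} \<Longrightarrow> \<bar>?f r\<bar> \<le> K"
    unfolding bounded_iff real_norm_def by blast
  show ?thesis
  proof (intro exI[of _ "max K 1"] conjI allI impI)
    show "?f r \<le> max K 1" if "r \<ge> 1" for r
      using R[of r] K[of r] that by (cases "r \<le> R") (auto simp: le_max_iff_disj)
  qed auto
qed

text \<open>
  Since p is arbitrary, this expresses rapid decay at 0 (take p large) as well as at infinity. Near infinity it
  follows from the exponential decay of the series, whose rate \<pi> exceeds 1; near 0 from the inversion
  symmetry, which exchanges p and - p.
\<close>
lemma Theta_axis_decay:
  "\<exists>C. \<forall>r>0. Theta_axis r \<le> C * r powr p * exp (- r)"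
proof -
  have large: "\<exists>C\<ge>0. \<forall>r\<ge>1. Theta_axis r \<le> C * (r powr q * exp (- r))" for q
  proof -
    define A where "A = 2 * pi\<^sup>2 * (exp pi * real_theta_moment 2 1)"
    have A: "A \<ge> 0" unfolding A_def by (intro mult_nonneg_nonneg real_theta_moment_nonneg) auto
    \<comment> \<open>The exponent 9/4 is the sum of the 1/4 from the branch factor and the 2 from r^2.\<close>
    obtain K where K: "K \<ge> 0" "\<And>r. r \<ge> 1 \<Longrightarrow> r powr (9/4 - q) * exp (- ((pi - 1) * r)) \<le> K"
      using powr_mult_exp_bounded[of "pi - 1" "9/4 - q"] pi_gt3 by auto
    have "Theta_axis r \<le> A * K * (r powr q * exp (- r))" if r: "r \<ge> 1" for r
    proof -
      have "theta_kernel r \<le> 2 * pi\<^sup>2 * r\<^sup>2 * real_theta_moment 2 r"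
        using real_theta_moment_nonneg[of r 1] r by (simp add: theta_kernel_def)
      also have "\<dots> \<le> 2 * pi\<^sup>2 * r\<^sup>2 * (exp pi * real_theta_moment 2 1 * exp (- (pi * r)))"
        by (intro mult_left_mono real_theta_moment_le r) auto
      finally have "Theta_axis r \<le> r powr (1/4) * (A * r\<^sup>2 * exp (- (pi * r)))"
        unfolding Theta_axis_def A_def by (intro mult_left_mono) (simp_all add: mult_ac)
      also have "\<dots> = A * ((r powr (9/4 - q) * exp (- ((pi - 1) * r))) * (r powr q * exp (- r)))"
      proof -
        have "r powr (9/4 - q) * r powr q = r powr (1/4) * r\<^sup>2"
          using r by (simp add: powr_add [symmetric] flip: powr_numeral)
        moreover have "exp (- ((pi - 1) * r)) * exp (- r) = exp (- (pi * r))"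
          by (simp add: algebra_simps flip: exp_add)
        moreover have "A * ((r powr (9/4 - q) * exp (- ((pi - 1) * r))) * (r powr q * exp (- r)))
            = A * (r powr (9/4 - q) * r powr q) * (exp (- ((pi - 1) * r)) * exp (- r))"
          by (simp only: mult_ac)
        ultimately show ?thesis by (simp only: mult_ac)
      qed
      also have "\<dots> \<le> A * (K * (r powr q * exp (- r)))"
        using K(2)[OF r] A by (intro mult_left_mono mult_right_mono) auto
      finally show ?thesis by (simp add: mult_ac)
    qed
    thus ?thesis using A K(1) by (intro exI[of _ "A * K"]) auto
  qed
  obtain C1 where C1: "C1 \<ge> 0" "\<And>r. r \<ge> 1 \<Longrightarrow> Theta_axis r \<le> C1 * (r powr p * exp (- r))"
    using large by blast
  obtain C2 where C2: "C2 \<ge> 0" "\<And>r. r \<ge> 1 \<Longrightarrow> Theta_axis r \<le> C2 * (r powr (- p) * exp (- r))"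
    using large by blast
  have "Theta_axis r \<le> (C1 + C2) * r powr p * exp (- r)" if r: "r > 0" for r
  proof (cases "r \<ge> 1")
    case True
    have "C1 * (r powr p * exp (- r)) \<le> (C1 + C2) * (r powr p * exp (- r))"
      using C2(1) by (intro mult_right_mono) auto
    thus ?thesis using C1(2)[OF True] by (simp only: mult.assoc)
  next
    case False
    hence inv: "1 / r \<ge> 1" using r by simp
    hence "r \<le> 1 / r" using False by linarith
    have "Theta_axis r \<le> C2 * ((1 / r) powr (- p) * exp (- (1 / r)))"
      using C2(2)[OF inv] r by (simp add: Theta_axis_inversion)
    also have "\<dots> \<le> C2 * (r powr p * exp (- r))"
    proof (intro mult_left_mono mult_mono)
      show "(1 / r) powr (- p) \<le> r powr p" using r by (simp add: powr_divide powr_minus_divide)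
      show "exp (- (1 / r)) \<le> exp (- r)" using \<open>r \<le> 1 / r\<close> by simp
    qed (use C2 in auto)
    also have "\<dots> \<le> (C1 + C2) * (r powr p * exp (- r))"
      using C1(1) by (intro mult_right_mono) auto
    finally show ?thesis by (simp only: mult.assoc)
  qed
  thus ?thesis by blast
qed

lemma Theta_axis_differentiable:
  assumes "r > 0"
  shows "Theta_axis field_differentiable (at r)"
proof -
  have "real_theta_moment k field_differentiable (at r)" for k
    using has_real_derivative_real_theta_moment[OF assms] field_differentiable_def by blast
  moreover have "(\<lambda>r. r powr (1/4)) field_differentiable (at r)"
    unfolding field_differentiable_def using has_real_derivative_powr[OF assms] by blast
  ultimately show ?thesis
    unfolding Theta_axis_def [abs_def] theta_kernel_def
    by (intro derivative_intros) auto
qed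

lemma continuous_on_Theta_axis: "continuous_on {0<..} Theta_axis"
  by (intro continuous_at_imp_continuous_on ballI field_differentiable_imp_continuous_at
      Theta_axis_differentiable) simp

section \<open>The Mellin transform and the xi function\<close>

lemma of_real_powr_conv_exp:
  assumes "r > 0"
  shows "complex_of_real r powr z = exp (z * of_real (ln r))"
  using assms by (simp add: powr_def Ln_of_real)

lemma norm_of_real_powr:
  assumes "r > 0"
  shows "norm (complex_of_real r powr z) = r powr Re z"
  using assms by (simp add: of_real_powr_conv_exp powr_def)

lemma continuous_on_of_real_powr [continuous_intros]:
  "continuous_on {0<..} (\<lambda>r. complex_of_real r powr z)"
proof -
  have "continuous_on {0<..} (\<lambda>r. exp (z * complex_of_real (ln r)))"
    by (intro continuous_intros) auto
  thus ?thesis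
    by (rule continuous_on_eq) (simp add: of_real_powr_conv_exp)
qed

text \<open>
  The substitution r \<rightarrow> a r in the Gamma integral.
\<close>
lemma scaled_gamma_integral:
  assumes z: "Re z > 0" and a: "a > 0"
  shows set_integrable_scaled_gamma:
      "set_integrable lborel {0<..} (\<lambda>r. of_real r powr (z - 1) * complex_of_real (exp (- (a * r))))" (is ?integrable)
    and set_integral_scaled_gamma:
      "(LINT r:{0<..}|lborel. of_real r powr (z - 1) * complex_of_real (exp (- (a * r))))
         = Gamma z * of_real a powr (- z)" (is ?integral)
proof -
  let ?f = "\<lambda>a r. of_real r powr (z - 1) * complex_of_real (exp (- (a * r)))"
  have eq: "?f a = (\<lambda>r. of_real r powr (z - 1) / of_real (exp (a * r)))" for a
    by (simp add: exp_minus field_simps fun_eq_iff)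
  have integrable: "set_integrable lborel {0<..} (?f a)" if "a > 0" for a
  proof -
    have "set_integrable lebesgue {0<..} (?f a)"
      unfolding eq by (rule absolutely_integrable_Gamma_integral[OF z that])
    moreover have "(\<lambda>x. indicator {0<..} x *\<^sub>R ?f a x) \<in> borel_measurable lborel"
      unfolding measurable_lborel2
      by (intro borel_measurable_continuous_on_indicator continuous_intros) auto
    ultimately show ?thesis
      unfolding set_integrable_def using integrable_completion by blast
  qed
  show ?integrable by (rule integrable[OF a])
  have "Gamma z = (LINT r:{0<..}|lborel. ?f 1 r)"
    using set_borel_integral_eq_integral(2)[OF integrable[of 1]] integral_unique[OF Gamma_integral_complex'[OF z]]
    unfolding eq by simp
  also have "\<dots> = a *\<^sub>R (LINT r|lborel. indicator {0<..} (0 + a * r) *\<^sub>R ?f 1 (0 + a * r))"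
    using lborel_integral_real_affine[of a "\<lambda>r. indicator {0<..} r *\<^sub>R ?f 1 r" 0] a
    unfolding set_lebesgue_integral_def by (simp only: abs_of_pos)
  also have "(\<lambda>r. indicator {0<..} (0 + a * r) *\<^sub>R ?f 1 (0 + a * r))
      = (\<lambda>r. of_real a powr (z - 1) * (indicator {0<..} r *\<^sub>R ?f a r))"
  proof
    fix r
    show "indicator {0<..} (0 + a * r) *\<^sub>R ?f 1 (0 + a * r)
        = of_real a powr (z - 1) * (indicator {0<..} r *\<^sub>R ?f a r)"
      using a by (cases "r > 0") (auto simp: indicator_def zero_less_mult_iff powr_times_real)
  qed
  also have "a *\<^sub>R (LINT r|lborel. of_real a powr (z - 1) * (indicator {0<..} r *\<^sub>R ?f a r))
      = of_real a powr z * (LINT r:{0<..}|lborel. ?f a r)"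
  proof -
    have "of_real a * of_real a powr (z - 1) = of_real a powr z"
      using a by (simp add: powr_diff)
    thus ?thesis
      unfolding integral_mult_right_zero set_lebesgue_integral_def scaleR_conv_of_real[of a] mult.assoc [symmetric]
      by simp
  qed
  finally show ?integral
    using a by (simp add: powr_minus)
qed

text \<open>
  The contribution of the n-th theta term to a Mellin transform, rewritten as a term of a Dirichlet series.
\<close>
lemma dirichlet_term:
  fixes z :: complex
  shows
  "of_nat (Suc n) ^ (2 * k) * of_real (pi * real (Suc n) ^ 2) powr (- z)
     = of_real pi powr (- z) * of_nat (Suc n) powr (of_nat (2 * k) - 2 * z)"
proof -
  have ln: "ln (pi * real (Suc n) ^ 2) = ln pi + 2 * ln (real (Suc n))"
    by (simp add: ln_mult ln_realpow del: of_nat_Suc)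
  have nat: "of_nat (Suc n) = complex_of_real (real (Suc n))" by simp
  have pow: "of_nat (Suc n) ^ (2 * k) = exp (of_nat (2 * k) * complex_of_real (ln (real (Suc n))))"
    unfolding exp_of_nat_mult by (simp add: exp_of_real del: of_nat_Suc)
  show ?thesis
    unfolding pow unfolding nat
    by (subst (1 2 3) of_real_powr_conv_exp)
       (auto simp: ln exp_add [symmetric] algebra_simps simp del: of_nat_Suc)
qed

text \<open>
  Term-by-term integration. It is legitimate because the integrals of the absolute values are the same
  expressions at the real point Re z, and they form a convergent series exactly when 2 Re z - 2 k > 1.
\<close>
lemma theta_moment_mellin:
  assumes z: "real k + 1/2 < Re z"
  shows set_integrable_theta_moment_mellin:
      "set_integrable lborel {0<..} (\<lambda>r. of_real r powr (z - 1) * complex_of_real (real_theta_moment k r))"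
    and theta_moment_mellin_sums:
      "(\<lambda>n. Gamma z * of_real pi powr (- z) * of_nat (Suc n) powr (of_nat (2 * k) - 2 * z)) sums
         (LINT r:{0<..}|lborel. of_real r powr (z - 1) * complex_of_real (real_theta_moment k r))"
proof -
  define g where "g = (\<lambda>n z r. of_nat (Suc n) ^ (2 * k) *
      (indicator {0<..} r *\<^sub>R (of_real r powr (z - 1) * complex_of_real (exp (- (pi * real (Suc n) ^ 2 * r))))))"
  have g_integrable: "integrable lborel (g n z)"
    and g_integral: "(LINT r|lborel. g n z r) =
        Gamma z * of_real pi powr (- z) * of_nat (Suc n) powr (of_nat (2 * k) - 2 * z)"
    if "Re z > 0" for n z
  proof -
    have a: "pi * real (Suc n) ^ 2 > 0" by simp
    show "integrable lborel (g n z)"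
      unfolding g_def using set_integrable_scaled_gamma[OF that a]
      by (intro integrable_mult_right) (simp only: set_integrable_def)
    have "(LINT r|lborel. g n z r) = of_nat (Suc n) ^ (2 * k) * (Gamma z * of_real (pi * real (Suc n) ^ 2) powr (- z))"
      unfolding g_def using set_integral_scaled_gamma[OF that a]
      by (simp only: set_lebesgue_integral_def integral_mult_right_zero)
    also have "\<dots> = Gamma z * (of_nat (Suc n) ^ (2 * k) * of_real (pi * real (Suc n) ^ 2) powr (- z))"
      by (simp only: mult_ac)
    finally show "(LINT r|lborel. g n z r) =
        Gamma z * of_real pi powr (- z) * of_nat (Suc n) powr (of_nat (2 * k) - 2 * z)"
      unfolding dirichlet_term by (simp only: mult_ac)
  qed
  have Re_z: "Re z > 0" using z by simp
  \<comment> \<open>Taking the absolute value of an integrand amounts to replacing z by its real part.\<close>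
  have norm_g: "complex_of_real (norm (g n z r)) = g n (of_real (Re z)) r" for n r
  proof (cases "r > 0")
    case True
    have "complex_of_real (norm (of_real r powr (z - 1))) = of_real r powr (of_real (Re z) - 1)"
      using True powr_of_real[of r "Re z - 1"] by (simp add: norm_of_real_powr)
    thus ?thesis using True
      by (simp add: g_def norm_mult norm_power del: of_nat_Suc)
  qed (simp add: g_def)
  have integral_norm_g: "(LINT r|lborel. norm (g n z r))
      = Re (Gamma (of_real (Re z))) * pi powr (- Re z) * real (Suc n) powr (2 * real k - 2 * Re z)" for n
  proof -
    have "complex_of_real (LINT r|lborel. norm (g n z r)) = (LINT r|lborel. g n (of_real (Re z)) r)"
      by (simp only: integral_complex_of_real [symmetric] norm_g)
    also have "\<dots> = Gamma (of_real (Re z)) * of_real pi powr (- of_real (Re z))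
        * of_nat (Suc n) powr (of_nat (2 * k) - 2 * of_real (Re z))"
      using Re_z by (intro g_integral) simp
    also have "of_real pi powr (- of_real (Re z)) = complex_of_real (pi powr (- Re z))"
      using powr_of_real[of pi "- Re z"] by simp
    also have "of_nat (Suc n) powr (of_nat (2 * k) - 2 * of_real (Re z))
        = complex_of_real (real (Suc n) powr (2 * real k - 2 * Re z))"
      using powr_of_real[of "real (Suc n)" "2 * real k - 2 * Re z"] by simp
    finally have "complex_of_real (LINT r|lborel. norm (g n z r)) = Gamma (of_real (Re z)) *
        complex_of_real (pi powr (- Re z)) * complex_of_real (real (Suc n) powr (2 * real k - 2 * Re z))" .
    hence "Re (complex_of_real (LINT r|lborel. norm (g n z r))) = Re (Gamma (of_real (Re z)) *
        complex_of_real (pi powr (- Re z)) * complex_of_real (real (Suc n) powr (2 * real k - 2 * Re z)))"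
      by (simp only:)
    thus ?thesis by simp
  qed
  have "summable (\<lambda>n. real (Suc n) powr (2 * real k - 2 * Re z))"
    using z summable_real_powr_iff[of "2 * real k - 2 * Re z"]
    by (subst summable_Suc_iff) simp
  hence sum_int: "summable (\<lambda>n. LINT r|lborel. norm (g n z r))"
    unfolding integral_norm_g by (rule summable_mult)
  have g_sums: "(\<lambda>n. g n z r) sums (indicator {0<..} r *\<^sub>R (of_real r powr (z - 1) * complex_of_real (real_theta_moment k r)))"
    and g_summable: "summable (\<lambda>n. norm (g n z r))" for r
  proof -
    have "(\<lambda>n. g n z r) sums (indicator {0<..} r *\<^sub>R (of_real r powr (z - 1) * complex_of_real (real_theta_moment k r)))
        \<and> summable (\<lambda>n. norm (g n z r))"
    proof (cases "r > 0")
      case True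
      have "g n z r = of_real r powr (z - 1) * of_real (real (Suc n) ^ (2 * k) * exp (- (pi * real (Suc n) ^ 2 * r)))" for n
        using True by (simp add: g_def mult_ac)
      moreover have "(\<lambda>n. norm (of_real r powr (z - 1)) * (real (Suc n) ^ (2 * k) * exp (- (pi * real (Suc n) ^ 2 * r))))
          sums (norm (complex_of_real r powr (z - 1)) * real_theta_moment k r)"
        by (intro sums_mult real_theta_moment_sums True)
      moreover have "(\<lambda>n. of_real r powr (z - 1) * complex_of_real (real (Suc n) ^ (2 * k) * exp (- (pi * real (Suc n) ^ 2 * r))))
          sums (of_real r powr (z - 1) * complex_of_real (real_theta_moment k r))"
        by (intro sums_mult sums_of_real real_theta_moment_sums True)
      ultimately show ?thesis
        using True by (simp add: norm_mult norm_power sums_iff del: of_nat_Suc of_real_mult of_real_power)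
    qed (simp add: g_def)
    thus "(\<lambda>n. g n z r) sums (indicator {0<..} r *\<^sub>R (of_real r powr (z - 1) * complex_of_real (real_theta_moment k r)))"
      and "summable (\<lambda>n. norm (g n z r))" by blast+
  qed
  have suminf_g: "(\<Sum>n. g n z r) = indicator {0<..} r *\<^sub>R (of_real r powr (z - 1) * complex_of_real (real_theta_moment k r))" for r
    using g_sums by (rule sums_unique [symmetric])
  note interchange = g_integrable[OF Re_z] AE_I2[OF g_summable] sum_int
  show "set_integrable lborel {0<..} (\<lambda>r. of_real r powr (z - 1) * complex_of_real (real_theta_moment k r))"
    using integrable_suminf[of lborel "\<lambda>n. g n z", OF interchange]
    unfolding suminf_g set_integrable_def .
  show "(\<lambda>n. Gamma z * of_real pi powr (- z) * of_nat (Suc n) powr (of_nat (2 * k) - 2 * z)) sums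
         (LINT r:{0<..}|lborel. of_real r powr (z - 1) * complex_of_real (real_theta_moment k r))"
    using sums_integral[of lborel "\<lambda>n. g n z", OF interchange]
    unfolding suminf_g g_integral[OF Re_z] set_lebesgue_integral_def .
qed

definition theta_mellin :: "complex \<Rightarrow> complex" where
  "theta_mellin z = integral {0<..} (\<lambda>r. of_real r powr (z - 1) * complex_of_real (Theta_axis r))"

text \<open>
  The two summands of theta_kernel are theta moments multiplied by r^2 and r, so their Mellin transforms are
  taken at s/2 + 2 and s/2 + 1, and both give the Dirichlet series of exponent s. By the functional equation
  of Gamma the factors combine to 2 (s/2 + 1) - 3 = s - 1, which removes the pole of \<zeta> at 1. The shift by
  1/4 in the argument comes from the branch factor r^(1/4).
\<close>
lemma theta_mellin_sums:
  assumes s: "Re s > 1"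
  shows "(\<lambda>n. of_real pi powr (- s / 2) * Gamma (s / 2 + 1) * (s - 1) * (1 / of_nat (Suc n) powr s))
           sums theta_mellin (s / 2 - 1/4)"
proof -
  let ?z1 = "s / 2 + 1" and ?z2 = "s / 2 + 2"
  let ?m = "\<lambda>k z r. of_real r powr (z - 1) * complex_of_real (real_theta_moment k r)"
  have z1: "real 1 + 1/2 < Re ?z1" and z2: "real 2 + 1/2 < Re ?z2" using s by auto
  let ?A = "2 * complex_of_real pi ^ 2" and ?B = "3 * complex_of_real pi"
  have integrand: "of_real r powr (s / 2 - 1/4 - 1) * complex_of_real (Theta_axis r) = ?A * ?m 2 ?z2 r - ?B * ?m 1 ?z1 r"
    if "r > 0" for r
  proof -
    have "complex_of_real (r powr (1/4)) = of_real r powr (1/4)"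
      using that powr_of_real[of r "1/4"] by simp
    hence e: "of_real r powr (s / 2 - 1/4 - 1) * complex_of_real (r powr (1/4)) = of_real r powr (s / 2 - 1)"
      by (simp add: powr_add [symmetric])
    have e': "of_real r powr (?z2 - 1) = of_real r powr (s / 2 - 1) * complex_of_real r ^ 2"
         "of_real r powr (?z1 - 1) = of_real r powr (s / 2 - 1) * complex_of_real r"
      using that by (simp_all add: powr_add powr_diff power2_eq_square)
    show ?thesis
      unfolding e' Theta_axis_def of_real_mult mult.assoc [symmetric] e
      by (simp add: theta_kernel_def algebra_simps)
  qed
  have int: "set_integrable lborel {0<..} (\<lambda>r. ?A * ?m 2 ?z2 r)" "set_integrable lborel {0<..} (\<lambda>r. ?B * ?m 1 ?z1 r)"
    by (intro set_integrable_mult_right set_integrable_theta_moment_mellin z1 z2)+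
  have "(\<lambda>n. ?A * (Gamma ?z2 * of_real pi powr (- ?z2) * of_nat (Suc n) powr (of_nat (2 * 2) - 2 * ?z2))
      - ?B * (Gamma ?z1 * of_real pi powr (- ?z1) * of_nat (Suc n) powr (of_nat (2 * 1) - 2 * ?z1)))
    sums (?A * (LINT r:{0<..}|lborel. ?m 2 ?z2 r) - ?B * (LINT r:{0<..}|lborel. ?m 1 ?z1 r))"
    by (intro sums_diff sums_mult theta_moment_mellin_sums z1 z2)
  also have "(?A * (LINT r:{0<..}|lborel. ?m 2 ?z2 r) - ?B * (LINT r:{0<..}|lborel. ?m 1 ?z1 r))
      = (LINT r:{0<..}|lborel. ?A * ?m 2 ?z2 r - ?B * ?m 1 ?z1 r)"
    using set_integral_diff(2)[OF int] by simp
  also have "\<dots> = integral {0<..} (\<lambda>r. ?A * ?m 2 ?z2 r - ?B * ?m 1 ?z1 r)"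
    by (rule set_borel_integral_eq_integral(2)[OF set_integral_diff(1)[OF int]])
  also have "\<dots> = theta_mellin (s / 2 - 1/4)"
    unfolding theta_mellin_def by (rule integral_cong [symmetric]) (simp only: integrand greaterThan_iff)
  also have "(\<lambda>n. ?A * (Gamma ?z2 * of_real pi powr (- ?z2) * of_nat (Suc n) powr (of_nat (2 * 2) - 2 * ?z2))
      - ?B * (Gamma ?z1 * of_real pi powr (- ?z1) * of_nat (Suc n) powr (of_nat (2 * 1) - 2 * ?z1)))
    = (\<lambda>n. of_real pi powr (- s / 2) * Gamma (s / 2 + 1) * (s - 1) * (1 / of_nat (Suc n) powr s))"
  proof
    fix n
    have "Gamma ?z2 = (s / 2 + 1) * Gamma ?z1"
    proof -
      have "?z1 \<notin> \<int>\<^sub>\<le>\<^sub>0" using s by (auto elim!: nonpos_Ints_cases simp: complex_eq_iff)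
      hence "Gamma (?z1 + 1) = ?z1 * Gamma ?z1" by (rule Gamma_plus1)
      thus ?thesis by (simp add: algebra_simps)
    qed
    moreover have "of_real pi powr (- ?z2) = complex_of_real pi powr (- s / 2) / complex_of_real pi ^ 2"
      "of_real pi powr (- ?z1) = complex_of_real pi powr (- s / 2) / complex_of_real pi"
    proof -
      have "- ?z2 = - s / 2 - of_nat 2" "- ?z1 = - s / 2 - 1" by (simp_all add: algebra_simps)
      thus "of_real pi powr (- ?z2) = complex_of_real pi powr (- s / 2) / complex_of_real pi ^ 2"
      "of_real pi powr (- ?z1) = complex_of_real pi powr (- s / 2) / complex_of_real pi"
        by (simp_all only: powr_diff powr_nat' of_real_eq_0_iff pi_neq_zero) simp_all
    qed
    moreover have "of_nat (2 * 2) - 2 * ?z2 = - s" "of_nat (2 * 1) - 2 * ?z1 = - s"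
      by (simp_all add: algebra_simps)
    moreover have "2 * a ^ 2 * ((z * g) * (p / a ^ 2) * q) - 3 * a * (g * (p / a) * q) = p * g * (2 * z - 3) * q"
      if "a \<noteq> 0" for a z g p q :: complex
      using that by (simp add: field_simps)
    moreover have "2 * ?z1 - 3 = s - 1" by simp
    moreover have "of_nat (Suc n) powr (- s) = 1 / (of_nat (Suc n) powr s :: complex)"
      by (simp only: powr_minus inverse_eq_divide)
    ultimately show "?A * (Gamma ?z2 * of_real pi powr (- ?z2) * of_nat (Suc n) powr (of_nat (2 * 2) - 2 * ?z2))
      - ?B * (Gamma ?z1 * of_real pi powr (- ?z1) * of_nat (Suc n) powr (of_nat (2 * 1) - 2 * ?z1))
      = of_real pi powr (- s / 2) * Gamma (s / 2 + 1) * (s - 1) * (1 / of_nat (Suc n) powr s)"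
      by (simp only: of_real_eq_0_iff pi_neq_zero not_False_eq_True)
  qed
  finally show ?thesis .
qed

text \<open>
  A bound that is uniform on vertical strips: for r \<ge> 1 the worst exponent in the strip is M - 1, for r \<le> 1 it
  is - M - 1, and the decay of Theta_axis is used with the opposite exponents 1 - M and M + 1.
\<close>
lemma Theta_mellin_integrand_bound:
  assumes "M \<ge> 0"
  shows "\<exists>C. \<forall>z r. \<bar>Re z\<bar> \<le> M \<longrightarrow> r > 0 \<longrightarrow>
           norm (of_real r powr (z - 1) * complex_of_real (Theta_axis r)) \<le> C * exp (- r)"
proof -
  obtain C1 where C1: "\<And>r. r > 0 \<Longrightarrow> Theta_axis r \<le> C1 * r powr (1 - M) * exp (- r)"
    using Theta_axis_decay by blast
  obtain C2 where C2: "\<And>r. r > 0 \<Longrightarrow> Theta_axis r \<le> C2 * r powr (M + 1) * exp (- r)"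
    using Theta_axis_decay by blast
  have pos: "C1 > 0" "C2 > 0"
    using C1[of 1] C2[of 1] Theta_axis_pos[of 1]
    by (auto simp: zero_less_mult_iff intro: less_le_trans dest!: less_le_trans[rotated])
  have "norm (of_real r powr (z - 1) * complex_of_real (Theta_axis r)) \<le> (C1 + C2) * exp (- r)"
    if z: "\<bar>Re z\<bar> \<le> M" and r: "r > 0" for z r
  proof -
    have norm: "norm (of_real r powr (z - 1) * complex_of_real (Theta_axis r)) = r powr (Re z - 1) * Theta_axis r"
      using r Theta_axis_pos[OF r] by (simp add: norm_mult norm_of_real_powr)
    show ?thesis
    proof (cases "r \<ge> 1")
      case True
      have "r powr (Re z - 1) * Theta_axis r \<le> r powr (M - 1) * (C1 * r powr (1 - M) * exp (- r))"
        using z r True Theta_axis_pos[OF r] by (intro mult_mono C1 powr_mono) auto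
      also have "\<dots> = C1 * exp (- r)" using r by (simp add: powr_add [symmetric])
      also have "\<dots> \<le> (C1 + C2) * exp (- r)" using pos by (intro mult_right_mono) auto
      finally show ?thesis unfolding norm .
    next
      case False
      have "r powr (Re z - 1) * Theta_axis r \<le> r powr (- M - 1) * (C2 * r powr (M + 1) * exp (- r))"
        using z r False Theta_axis_pos[OF r] by (intro mult_mono C2 powr_mono') auto
      also have "\<dots> = C2 * exp (- r)" using r by (simp add: powr_add [symmetric])
      also have "\<dots> \<le> (C1 + C2) * exp (- r)" using pos by (intro mult_right_mono) auto
      finally show ?thesis unfolding norm .
    qed
  qed
  thus ?thesis by blast
qed

lemma continuous_on_Theta_mellin_integrand:
  "continuous_on {0<..} (\<lambda>r. of_real r powr (z - 1) * complex_of_real (Theta_axis r))"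
  by (intro continuous_intros continuous_on_Theta_axis)

lemma has_integral_exp_minus_pos: "((\<lambda>r::real. exp (- r)) has_integral 1) {0<..}"
proof -
  have "((\<lambda>r::real. exp (- r)) has_integral 1) {0..}"
    using has_integral_exp_minus_to_infinity[of 1 0] by simp
  moreover have "negligible {r \<in> {0..} - {0<..}. exp (- r) \<noteq> (0::real)}"
    by (rule negligible_subset[of "{0}"]) auto
  moreover have "negligible {r \<in> {0<..} - {0..}. exp (- r) \<noteq> (0::real)}"
    by (rule negligible_subset[of "{0}"]) auto
  ultimately show ?thesis
    by (subst has_integral_spike_set_eq[of _ "{0..}"])
qed

lemma Theta_mellin_integrable:
  assumes "A \<in> sets borel" "A \<subseteq> {0<..}"
  shows "(\<lambda>r. of_real r powr (z - 1) * complex_of_real (Theta_axis r)) integrable_on A"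
proof -
  let ?f = "\<lambda>r. of_real r powr (z - 1) * complex_of_real (Theta_axis r)"
  obtain C where C: "\<And>r. r > 0 \<Longrightarrow> norm (?f r) \<le> C * exp (- r)"
    using Theta_mellin_integrand_bound[of "\<bar>Re z\<bar>"] by auto
  \<comment> \<open>The dominating function C e^(-r) is, up to its constant, the integrand of Gamma at 1.\<close>
  have "set_integrable lborel {0<..} (\<lambda>r. of_real C * (of_real r powr (1 - 1) * complex_of_real (exp (- (1 * r)))))"
    by (intro set_integrable_mult_right set_integrable_scaled_gamma) auto
  moreover have "set_borel_measurable lborel {0<..} ?f"
    unfolding set_borel_measurable_def measurable_lborel2
    by (intro borel_measurable_continuous_on_indicator continuous_on_Theta_mellin_integrand) auto
  moreover have "norm (?f r) \<le> norm (of_real C * (of_real r powr (1 - 1) * complex_of_real (exp (- (1 * r)))))"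
    if "r \<in> {0<..}" for r
  proof -
    have "C * exp (- r) \<le> \<bar>C\<bar> * exp (- r)" by (intro mult_right_mono) auto
    moreover have "norm (of_real C * (of_real r powr (1 - 1) * complex_of_real (exp (- (1 * r))))) = \<bar>C\<bar> * exp (- r)"
      using that by (simp add: norm_mult)
    moreover have "norm (?f r) \<le> C * exp (- r)" using C that by simp
    ultimately show ?thesis by linarith
  qed
  ultimately have "set_integrable lborel {0<..} ?f"
    by (intro set_integrable_bound[of lborel "{0<..}" _ ?f] AE_I2 impI)
  hence "set_integrable lborel A ?f"
    by (rule set_integrable_subset) (use assms in auto)
  thus ?thesis by (rule set_borel_integral_eq_integral(1))
qed

lemma integral_truncation_bound:
  fixes f :: "'a::euclidean_space \<Rightarrow> 'b::banach"
  assumes "f integrable_on S" "f integrable_on T" "g integrable_on S" "g integrable_on T"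
    and "T \<subseteq> S" and "\<And>x. x \<in> S \<Longrightarrow> norm (f x) \<le> g x"
  shows "norm (integral S f - integral T f) \<le> integral S g - integral T g"
proof -
  have neg: "negligible (T - S)" using assms(5) by (simp add: Diff_eq_empty_iff[THEN iffD2])
  have f: "(f has_integral (integral S f - integral T f)) (S - T)"
    using assms by (intro has_integral_setdiff neg) auto
  have g: "(g has_integral (integral S g - integral T g)) (S - T)"
    using assms by (intro has_integral_setdiff neg) auto
  show ?thesis
    using Henstock_Kurzweil_Integration.integral_norm_bound_integral
      [OF has_integral_integrable[OF f] has_integral_integrable[OF g]] assms(6)
    by (simp add: integral_unique[OF f] integral_unique[OF g])
qed

text \<open>
  The truncated integrals over [1/(N+1), N+1] are holomorphic. By the uniform bound C e^(-r) on the integrand,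
  they converge locally uniformly to the full integral.
\<close>
lemma theta_mellin_holomorphic: "theta_mellin holomorphic_on UNIV"
proof -
  let ?f = "\<lambda>z r. of_real r powr (z - 1) * complex_of_real (Theta_axis r)"
  let ?a = "\<lambda>N. 1 / (real N + 1)" and ?b = "\<lambda>N. real N + 1"
  define T where "T = (\<lambda>N z. integral (cbox (?a N) (?b N)) (?f z))"
  have sub: "cbox (?a N) (?b N) \<subseteq> {0<..}" for N
    by (auto intro: less_le_trans[of 0 "?a N"])
  have int_T: "?f z integrable_on cbox (?a N) (?b N)" for z N
    by (rule Theta_mellin_integrable[OF _ sub]) simp
  have hol: "T N holomorphic_on UNIV" for N
    unfolding T_def
  proof (rule leibniz_rule_holomorphic)
    fix z :: complex and r assume "r \<in> cbox (?a N) (?b N)"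
    hence r: "r > 0" using sub by blast
    show "((\<lambda>z. ?f z r) has_field_derivative
        (exp ((z - 1) * of_real (ln r)) * of_real (ln r) * of_real (Theta_axis r))) (at z within UNIV)"
      unfolding of_real_powr_conv_exp[OF r] by (auto intro!: derivative_eq_intros)
  next
    have "continuous_on (UNIV \<times> cbox (?a N) (?b N))
       (\<lambda>p. exp ((fst p - 1) * of_real (ln (snd p))) * of_real (ln (snd p)) * complex_of_real (Theta_axis (snd p)))"
      by (intro continuous_intros continuous_on_compose2[OF continuous_on_Theta_axis])
         (use sub in force)+
    thus "continuous_on (UNIV \<times> cbox (?a N) (?b N))
       (\<lambda>(z, r). exp ((z - 1) * of_real (ln r)) * of_real (ln r) * complex_of_real (Theta_axis r))"
      by (simp add: case_prod_unfold)
  qed (use int_T in auto)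
  have unif: "uniform_limit (cball z 1) T theta_mellin sequentially" for z
  proof -
    obtain C where C: "\<And>w r. \<bar>Re w\<bar> \<le> norm z + 1 \<Longrightarrow> r > 0 \<Longrightarrow> norm (?f w r) \<le> C * exp (- r)"
      using Theta_mellin_integrand_bound[of "norm z + 1"] by auto
    have exp_T: "((\<lambda>r. C * exp (- r)) has_integral C * (exp (- ?a N) - exp (- ?b N))) (cbox (?a N) (?b N))" for N
    proof -
      have "?a N \<le> ?b N" by (simp add: field_simps)
      hence "((\<lambda>r. C * exp (- r)) has_integral (- C * exp (- ?b N) - (- C * exp (- ?a N)))) {?a N..?b N}"
        by (intro fundamental_theorem_of_calculus)
           (auto intro!: derivative_eq_intros simp flip: has_real_derivative_iff_has_vector_derivative)
      thus ?thesis by (simp add: algebra_simps)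
    qed
    have exp_S: "((\<lambda>r. C * exp (- r)) has_integral C * 1) {0<..}"
      by (intro has_integral_mult_right has_integral_exp_minus_pos)
    have bound: "norm (T N w - theta_mellin w) \<le> C * (1 - (exp (- ?a N) - exp (- ?b N)))"
      if "w \<in> cball z 1" for N w
    proof -
      have "\<bar>Re w\<bar> \<le> norm z + 1"
        using abs_Re_le_cmod[of w] norm_triangle_ineq2[of w z] that by (auto simp: dist_norm norm_minus_commute)
      hence "norm (theta_mellin w - T N w) \<le> C * 1 - C * (exp (- ?a N) - exp (- ?b N))"
        unfolding theta_mellin_def T_def integral_unique[OF exp_T, symmetric] integral_unique[OF exp_S, symmetric]
        using C sub[of N]
        by (intro integral_truncation_bound Theta_mellin_integrable int_T
            has_integral_integrable[OF exp_T] has_integral_integrable[OF exp_S]) auto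
      thus ?thesis by (simp add: norm_minus_commute algebra_simps)
    qed
    have "(\<lambda>N. C * (1 - (exp (- ?a N) - exp (- ?b N)))) \<longlonglongrightarrow> C * (1 - (exp (- 0) - 0))"
      by (intro tendsto_intros) real_asymp+
    hence lim: "(\<lambda>N. C * (1 - (exp (- ?a N) - exp (- ?b N)))) \<longlonglongrightarrow> 0" by simp
    show ?thesis
    proof (rule uniform_limitI)
      fix e :: real assume "e > 0"
      with lim have "\<forall>\<^sub>F N in sequentially. C * (1 - (exp (- ?a N) - exp (- ?b N))) < e"
        by (rule order_tendstoD)
      thus "\<forall>\<^sub>F N in sequentially. \<forall>w\<in>cball z 1. dist (T N w) (theta_mellin w) < e"
        by eventually_elim (unfold dist_norm, blast intro: le_less_trans[OF bound])
    qed
  qed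
  show ?thesis
    by (rule holomorphic_uniform_sequence[of UNIV T]) (use hol unif in \<open>auto intro!: exI[of _ 1]\<close>)
qed

text \<open>
  The right-hand side is holomorphic away from 1, and it is the sum of the Dirichlet series for Re s > 1 by the
  product formula of theta_mellin_sums. So an analytic continuation exists, and hence the chosen function
  riemann_zeta is one. The identity theorem shows that the two agree.
\<close>
lemma riemann_zeta_eq:
  assumes "s \<noteq> 1"
  shows "riemann_zeta s = of_real pi powr (s / 2) * rGamma (s / 2 + 1) * theta_mellin (s / 2 - 1/4) / (s - 1)"
proof -
  define f where "f = (\<lambda>s. of_real pi powr (s / 2) * rGamma (s / 2 + 1) * theta_mellin (s / 2 - 1/4) / (s - 1))"
  let ?P = "\<lambda>f. f holomorphic_on (- {1}) \<and> (\<forall>s. Re s > 1 \<longrightarrow> (\<lambda>n. 1 / of_nat (Suc n) powr s) sums f s)"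
  have "theta_mellin \<circ> (\<lambda>s. s / 2 - 1/4) holomorphic_on (- {1})"
    by (intro holomorphic_on_compose holomorphic_intros holomorphic_on_subset[OF theta_mellin_holomorphic]) auto
  hence hol: "f holomorphic_on (- {1})"
    unfolding f_def o_def by (intro holomorphic_intros) auto
  have sums: "(\<lambda>n. 1 / of_nat (Suc n) powr s) sums f s" if s: "Re s > 1" for s
  proof -
    have nz: "s - 1 \<noteq> 0" using s by auto
    have "s / 2 + 1 \<notin> \<int>\<^sub>\<le>\<^sub>0" using s by (auto elim!: nonpos_Ints_cases simp: complex_eq_iff)
    hence gamma: "rGamma (s / 2 + 1) * Gamma (s / 2 + 1) = 1"
      by (simp add: Gamma_def Gamma_eq_zero_iff rGamma_eq_zero_iff)
    have pi: "of_real pi powr (s / 2) * of_real pi powr (- s / 2) = (1 :: complex)"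
      by (simp add: powr_add [symmetric])
    have "(\<lambda>n. of_real pi powr (s / 2) * rGamma (s / 2 + 1) / (s - 1) *
        (of_real pi powr (- s / 2) * Gamma (s / 2 + 1) * (s - 1) * (1 / of_nat (Suc n) powr s)))
        sums (of_real pi powr (s / 2) * rGamma (s / 2 + 1) / (s - 1) * theta_mellin (s / 2 - 1/4))"
      by (intro sums_mult theta_mellin_sums s)
    also have "of_real pi powr (s / 2) * rGamma (s / 2 + 1) / (s - 1) * theta_mellin (s / 2 - 1/4) = f s"
      by (simp add: f_def)
    also have "(\<lambda>n. of_real pi powr (s / 2) * rGamma (s / 2 + 1) / (s - 1) *
        (of_real pi powr (- s / 2) * Gamma (s / 2 + 1) * (s - 1) * (1 / of_nat (Suc n) powr s)))
      = (\<lambda>n. 1 / of_nat (Suc n) powr s)"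
    proof
      fix n
      have cancel: "p * g / d * (p' * g' * d * x) = (p * p') * (g * g') * x" if "d \<noteq> 0" for p p' g g' d x :: complex
        using that by (simp add: field_simps)
      show "of_real pi powr (s / 2) * rGamma (s / 2 + 1) / (s - 1) *
        (of_real pi powr (- s / 2) * Gamma (s / 2 + 1) * (s - 1) * (1 / of_nat (Suc n) powr s))
        = 1 / of_nat (Suc n) powr s"
        unfolding cancel[OF nz] gamma pi by simp
    qed
    finally show ?thesis .
  qed
  have "?P riemann_zeta"
    unfolding riemann_zeta_def by (rule someI[of ?P f]) (use hol sums in blast)
  hence zeta_hol: "riemann_zeta holomorphic_on (- {1})"
    and zeta_sums: "\<And>s. Re s > 1 \<Longrightarrow> (\<lambda>n. 1 / of_nat (Suc n) powr s) sums riemann_zeta s"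
    by blast+
  have "riemann_zeta s = f s"
  proof (rule analytic_continuation_open[of "{s. Re s > 1}" "- {1}" riemann_zeta f])
    show "open {s. Re s > 1}" by (rule open_halfspace_Re_gt)
    show "{s. Re s > 1} \<noteq> {}" by (auto intro: exI[of _ 2])
    show "connected (- {1 :: complex})" by (rule connected_punctured_universe) simp
    show "riemann_zeta z = f z" if "z \<in> {s. Re s > 1}" for z
      using that zeta_sums sums sums_unique2 by blast
  qed (use assms zeta_hol hol in auto)
  thus ?thesis by (simp add: f_def)
qed

text \<open>
  Insert the formula for \<zeta> and cancel the Gamma factors. The cancellation is valid except at 1 and at the
  poles of Gamma(w/2); these points are isolated, so the limits filled in by remove_sings are those of the
  entire function on the right.
\<close>
lemma riemann_xi_eq: "riemann_xi s = theta_mellin (s / 2 - 1/4)"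
proof -
  let ?f = "\<lambda>s. 1/2 * s * (s - 1) * of_real pi powr (- s / 2) * Gamma (s / 2) * riemann_zeta s"
  \<comment> \<open>The points at which the cancellation may fail, apart from s itself.\<close>
  define X where "X = {w. w = 1 \<or> w / 2 \<in> \<int>\<^sub>\<le>\<^sub>0} - {s}"
  have "X \<subseteq> \<int>"
  proof
    fix w assume "w \<in> X"
    hence "w = 1 \<or> w / 2 \<in> \<int>" unfolding X_def using nonpos_Ints_subset_Ints by blast
    thus "w \<in> \<int>"
    proof
      assume "w / 2 \<in> \<int>"
      hence "2 * (w / 2) \<in> \<int>" by (intro Ints_mult) auto
      thus ?thesis by simp
    qed simp
  qed
  hence "open (- X)" by (intro open_Compl closed_subset_Ints)
  hence "eventually (\<lambda>w. w \<in> - X - {s}) (at s)"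
    by (rule eventually_at_in_open) (simp add: X_def)
  hence "eventually (\<lambda>w. ?f w = theta_mellin (w / 2 - 1/4)) (at s)"
  proof eventually_elim
    case (elim w)
    hence w: "w - 1 \<noteq> 0" "w / 2 \<notin> \<int>\<^sub>\<le>\<^sub>0" by (auto simp: X_def)
    hence w0: "w / 2 \<noteq> 0" by auto
    have "rGamma (w / 2) = w / 2 * rGamma (w / 2 + 1)" by (simp add: rGamma_plus1)
    moreover have "Gamma (w / 2) * rGamma (w / 2) = 1"
      using w(2) by (simp add: Gamma_def rGamma_eq_zero_iff)
    ultimately have "Gamma (w / 2) * (w / 2 * rGamma (w / 2 + 1)) = 1"
      by (simp only:)
    hence gamma: "w / 2 * (Gamma (w / 2) * rGamma (w / 2 + 1)) = 1"
      by (simp only: mult.left_commute)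
    have pi: "of_real pi powr (w / 2) * of_real pi powr (- w / 2) = (1 :: complex)"
      by (simp add: powr_add [symmetric])
    have "1/2 * w * d * p' * g * (p * g' * m / d) = (p * p') * (w / 2 * (g * g')) * m"
      if "d \<noteq> 0" for p p' g g' d m :: complex
      using that by (simp add: field_simps)
    from this[OF w(1)] show ?case
      using w(1) by (subst riemann_zeta_eq) (simp_all only: gamma pi, auto)
  qed
  moreover have "(\<lambda>w. theta_mellin (w / 2 - 1/4)) \<midarrow>s\<rightarrow> theta_mellin (s / 2 - 1/4)"
  proof -
    have "isCont theta_mellin (s / 2 - 1/4)"
      using theta_mellin_holomorphic holomorphic_on_imp_continuous_on continuous_on_eq_continuous_at by blast
    hence "isCont (\<lambda>w. theta_mellin (w / 2 - 1/4)) s"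
      by (rule isCont_o2[rotated]) (auto intro!: continuous_intros)
    thus ?thesis by (simp add: isCont_def)
  qed
  ultimately have "?f \<midarrow>s\<rightarrow> theta_mellin (s / 2 - 1/4)"
    by (subst tendsto_cong)
  thus ?thesis
    unfolding riemann_xi_def by (rule remove_sings_eqI)
qed

lemma riemann_Xi_eq: "riemann_Xi \<alpha> = theta_mellin (\<i> * \<alpha> / 2)"
  by (simp add: riemann_Xi_def riemann_xi_eq add_divide_distrib)

section \<open>The boundary value problem\<close>

definition partial_theta_mellin :: "complex \<Rightarrow> real \<Rightarrow> complex" where
  "partial_theta_mellin z R = integral {0<..R} (\<lambda>r. of_real r powr (z - 1) * complex_of_real (Theta_axis r))"

lemma has_vector_derivative_partial_theta_mellin:
  assumes "R > 0"
  shows "(partial_theta_mellin z has_vector_derivative of_real R powr (z - 1) * of_real (Theta_axis R)) (at R)"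
proof -
  let ?f = "\<lambda>r. of_real r powr (z - 1) * complex_of_real (Theta_axis r)"
  have split: "partial_theta_mellin z u = partial_theta_mellin z (R / 2) + integral {R / 2..u} ?f"
    if u: "u \<in> {R / 2<..<2 * R}" for u
  proof -
    have "{0<..u} = {0<..R / 2} \<union> {R / 2..u}" using u assms by auto
    moreover have "negligible ({0<..R / 2} \<inter> {R / 2..u})"
      by (rule negligible_subset[of "{R / 2}"]) auto
    moreover have "?f integrable_on {0<..R / 2}" "?f integrable_on {R / 2..u}"
      using assms by (intro Theta_mellin_integrable; force)+
    ultimately show ?thesis
      unfolding partial_theta_mellin_def by (simp only: Henstock_Kurzweil_Integration.integral_Un)
  qed
  have "continuous_on {R / 2..2 * R} ?f"
    by (rule continuous_on_subset[OF continuous_on_Theta_mellin_integrand]) (use assms in auto)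
  hence "((\<lambda>u. integral {R / 2..u} ?f) has_vector_derivative ?f R) (at R within {R / 2..2 * R})"
    using assms by (intro integral_has_vector_derivative) auto
  hence "((\<lambda>u. integral {R / 2..u} ?f) has_vector_derivative ?f R) (at R)"
    using assms by (subst (asm) at_within_interior) (auto simp: interior_atLeastAtMost_real)
  hence "((\<lambda>u. partial_theta_mellin z (R / 2) + integral {R / 2..u} ?f) has_vector_derivative ?f R) (at R)"
    by (auto intro!: derivative_eq_intros)
  thus ?thesis
    by (rule has_vector_derivative_transform_within_open[where S = "{R / 2<..<2 * R}"])
       (use assms split in auto)
qed

lemma partial_theta_mellin_limits:
  shows partial_theta_mellin_at_0: "(partial_theta_mellin z \<longlongrightarrow> 0) (at_right 0)"
    and partial_theta_mellin_at_top: "(partial_theta_mellin z \<longlongrightarrow> theta_mellin z) at_top"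
proof -
  let ?f = "\<lambda>r. of_real r powr (z - 1) * complex_of_real (Theta_axis r)"
  obtain C where C: "\<And>r. r > 0 \<Longrightarrow> norm (?f r) \<le> C * exp (- r)"
    using Theta_mellin_integrand_bound[of "\<bar>Re z\<bar>"] by auto
  have exp_R: "((\<lambda>r. C * exp (- r)) has_integral C * (1 - exp (- R))) {0<..R}" if "R > 0" for R
  proof -
    have "((\<lambda>r. C * exp (- r)) has_integral (- C * exp (- R) - (- C * exp (- 0)))) {0..R}"
      using that by (intro fundamental_theorem_of_calculus)
         (auto intro!: derivative_eq_intros simp flip: has_real_derivative_iff_has_vector_derivative)
    moreover have "negligible {r \<in> {0<..R} - {0..R}. C * exp (- r) \<noteq> 0}"
      by (rule negligible_subset[of "{0}"]) auto
    moreover have "negligible {r \<in> {0..R} - {0<..R}. C * exp (- r) \<noteq> 0}"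
      by (rule negligible_subset[of "{0}"]) auto
    ultimately have "((\<lambda>r. C * exp (- r)) has_integral (- C * exp (- R) - (- C * exp (- 0)))) {0<..R}"
      by (subst has_integral_spike_set_eq[of _ "{0..R}"])
    thus ?thesis by (simp add: algebra_simps)
  qed
  have exp_S: "((\<lambda>r. C * exp (- r)) has_integral C * 1) {0<..}"
    by (intro has_integral_mult_right has_integral_exp_minus_pos)
  show "(partial_theta_mellin z \<longlongrightarrow> 0) (at_right 0)"
  proof (rule Lim_null_comparison)
    have "norm (partial_theta_mellin z R) \<le> C * (1 - exp (- R))" if "R > 0" for R
      unfolding partial_theta_mellin_def integral_unique[OF exp_R[OF that], symmetric]
      by (intro Henstock_Kurzweil_Integration.integral_norm_bound_integral Theta_mellin_integrable
          has_integral_integrable[OF exp_R[OF that]]) (auto intro: C)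
    thus "\<forall>\<^sub>F R in at_right 0. norm (partial_theta_mellin z R) \<le> C * (1 - exp (- R))"
      by (auto intro: eventually_at_rightI[of 0 1])
    have "((\<lambda>R. C * (1 - exp (- R))) \<longlongrightarrow> C * (1 - exp (- 0))) (at_right 0)"
      by (intro tendsto_intros)
    thus "((\<lambda>R. C * (1 - exp (- R))) \<longlongrightarrow> 0) (at_right 0)" by simp
  qed
  have "((\<lambda>R. theta_mellin z - partial_theta_mellin z R) \<longlongrightarrow> 0) at_top"
  proof (rule Lim_null_comparison)
    have "norm (theta_mellin z - partial_theta_mellin z R) \<le> C * 1 - C * (1 - exp (- R))" if "R > 0" for R
      unfolding theta_mellin_def partial_theta_mellin_def
        integral_unique[OF exp_R[OF that], symmetric] integral_unique[OF exp_S, symmetric]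
      by (intro integral_truncation_bound Theta_mellin_integrable
            has_integral_integrable[OF exp_R[OF that]] has_integral_integrable[OF exp_S]) (auto intro: C)
    thus "\<forall>\<^sub>F R in at_top. norm (theta_mellin z - partial_theta_mellin z R) \<le> C * exp (- R)"
      by (intro eventually_mono[OF eventually_gt_at_top[of 0]]) (simp add: algebra_simps)
    show "((\<lambda>R. C * exp (- R)) \<longlongrightarrow> 0) at_top" by real_asymp
  qed
  from tendsto_diff[OF tendsto_const[of "theta_mellin z"] this]
  show "(partial_theta_mellin z \<longlongrightarrow> theta_mellin z) at_top" by simp
qed

definition Theta_profile :: "real \<Rightarrow> real" where
  "Theta_profile t = Theta_axis (t\<^sup>2)"

lemma Theta_profile_pos: "t > 0 \<Longrightarrow> Theta_profile t > 0"
  by (simp add: Theta_profile_def Theta_axis_pos)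

lemma Theta00_profile: "t > 0 \<Longrightarrow> Theta00 (\<i> * of_real (t\<^sup>2)) = of_real (Theta_profile t)"
  unfolding Theta_profile_def by (rule Theta00_imaginary_axis) simp

lemma Theta_profile_has_derivative:
  assumes "t > 0"
  obtains D where "(Theta_profile has_real_derivative D) (at t)"
proof -
  obtain d where "(Theta_axis has_real_derivative d) (at (t\<^sup>2))"
    using Theta_axis_differentiable[of "t\<^sup>2"] assms by (auto simp: field_differentiable_def)
  moreover have "((\<lambda>t. t\<^sup>2) has_real_derivative 2 * t) (at t)"
    by (auto intro!: derivative_eq_intros)
  ultimately show ?thesis
    using that DERIV_chain2[of Theta_axis d "\<lambda>t. t\<^sup>2" t "2 * t" UNIV] unfolding Theta_profile_def by blast
qed

definition weighted_integral :: "complex \<Rightarrow> real \<Rightarrow> complex" where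
  "weighted_integral \<alpha> t =
     integral {0<..t} (\<lambda>y. of_real y powr (\<i> * \<alpha>) * Theta00 (\<i> * of_real (y\<^sup>2)) / of_real y)"

text \<open>
  The substitution r = t^2 between the variable of Theta_axis and the variable of the boundary value problem,
  in differential form. The factor 1/2 compensates for dr/r = 2 dt/t.
\<close>
lemma has_vector_derivative_half_partial_theta_mellin:
  assumes "t > 0"
  shows "((\<lambda>t. partial_theta_mellin (z / 2) (t\<^sup>2) / 2) has_vector_derivative
            of_real t powr z * of_real (Theta_profile t) / of_real t) (at t)"
proof -
  have "(partial_theta_mellin (z / 2) \<circ> (\<lambda>t. t\<^sup>2) has_vector_derivative
      (2 * t) *\<^sub>R (of_real (t\<^sup>2) powr (z / 2 - 1) * of_real (Theta_axis (t\<^sup>2)))) (at t)"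
    using assms
    by (intro vector_diff_chain_at has_vector_derivative_partial_theta_mellin)
       (auto intro!: derivative_eq_intros simp flip: has_real_derivative_iff_has_vector_derivative)
  hence "((\<lambda>t. partial_theta_mellin (z / 2) (t\<^sup>2) / 2) has_vector_derivative
      (2 * t) *\<^sub>R (of_real (t\<^sup>2) powr (z / 2 - 1) * of_real (Theta_axis (t\<^sup>2))) / 2) (at t)"
    unfolding o_def by (rule has_vector_derivative_divide)
  also have "(2 * t) *\<^sub>R (of_real (t\<^sup>2) powr (z / 2 - 1) * of_real (Theta_axis (t\<^sup>2))) / 2
      = of_real t powr z * of_real (Theta_profile t) / of_real t"
  proof -
    have "complex_of_real (t\<^sup>2) powr (z / 2 - 1) = exp (z * of_real (ln t) - 2 * of_real (ln t))"
      using assms by (simp add: of_real_powr_conv_exp ln_realpow algebra_simps del: of_real_power)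
    also have "\<dots> = of_real t powr z / of_real (exp (2 * ln t))"
      using assms by (simp add: exp_diff of_real_powr_conv_exp exp_of_real [symmetric])
    also have "exp (2 * ln t) = t\<^sup>2"
      using assms by (simp add: exp_double)
    finally show ?thesis
      using assms by (simp add: Theta_profile_def scaleR_conv_of_real power2_eq_square field_simps)
  qed
  finally show ?thesis .
qed

text \<open>
  By the fundamental theorem of calculus: both sides have the same derivative on the positive half-line, and the
  right-hand side extends continuously by 0 to t = 0.
\<close>
lemma weighted_integral_eq:
  assumes t: "t > 0"
  shows "weighted_integral \<alpha> t = partial_theta_mellin (\<i> * \<alpha> / 2) (t\<^sup>2) / 2"
proof -
  let ?f = "\<lambda>y. of_real y powr (\<i> * \<alpha>) * Theta00 (\<i> * of_real (y\<^sup>2)) / of_real y"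
  define P where "P = (\<lambda>y. if y \<le> 0 then 0 else partial_theta_mellin (\<i> * \<alpha> / 2) (y\<^sup>2) / 2)"
  have P_deriv: "(P has_vector_derivative ?f y) (at y)" if "y > 0" for y
  proof (rule has_vector_derivative_transform_within_open[where S = "{0<..}"])
    show "((\<lambda>t. partial_theta_mellin (\<i> * \<alpha> / 2) (t\<^sup>2) / 2) has_vector_derivative ?f y) (at y)"
      unfolding Theta00_profile[OF that] by (rule has_vector_derivative_half_partial_theta_mellin[OF that])
  qed (use that in \<open>auto simp: P_def\<close>)
  have sq: "filterlim (\<lambda>y::real. y\<^sup>2) (at_right 0) (at_right 0)"
    by real_asymp
  have "((\<lambda>y. partial_theta_mellin (\<i> * \<alpha> / 2) (y\<^sup>2) / 2) \<longlongrightarrow> 0 / 2) (at_right 0)"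
    by (intro tendsto_divide filterlim_compose[OF partial_theta_mellin_at_0 sq] tendsto_const) auto
  hence "(P \<longlongrightarrow> 0) (at_right 0)"
    by (rule Lim_transform_eventually[THEN tendsto_eq_rhs])
       (auto simp: P_def intro!: eventually_at_rightI[of 0 1])
  hence "continuous (at 0 within {0..t}) P"
    using t by (simp add: continuous_within P_def at_within_Icc_at_right)
  moreover have "continuous (at y within {0..t}) P" if "y > 0" for y
    using P_deriv[OF that] has_vector_derivative_continuous continuous_at_imp_continuous_at_within by blast
  ultimately have "continuous_on {0..t} P"
    using t by (fastforce simp: continuous_on_eq_continuous_within le_less)
  hence "(?f has_integral (P t - P 0)) {0..t}"
    using t by (intro fundamental_theorem_of_calculus_interior P_deriv) auto
  moreover have "negligible {y \<in> {0<..t} - {0..t}. ?f y \<noteq> 0}" "negligible {y \<in> {0..t} - {0<..t}. ?f y \<noteq> 0}"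
    by (rule negligible_subset[of "{0}"]; auto)+
  ultimately have "(?f has_integral (P t - P 0)) {0<..t}"
    by (subst has_integral_spike_set_eq[of _ "{0..t}"])
  thus ?thesis
    using t by (simp add: weighted_integral_def P_def integral_unique)
qed

lemma has_vector_derivative_weighted_integral:
  assumes "t > 0"
  shows "(weighted_integral \<alpha> has_vector_derivative
            of_real t powr (\<i> * \<alpha>) * of_real (Theta_profile t) / of_real t) (at t)"
  by (rule has_vector_derivative_transform_within_open
        [OF has_vector_derivative_half_partial_theta_mellin, where S = "{0<..}"])
     (use assms in \<open>auto simp: weighted_integral_eq\<close>)

lemma weighted_integral_limits:
  shows weighted_integral_at_0: "(weighted_integral \<alpha> \<longlongrightarrow> 0) (at_right 0)"
    and weighted_integral_at_top: "(weighted_integral \<alpha> \<longlongrightarrow> riemann_Xi \<alpha> / 2) at_top"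
proof -
  have "((\<lambda>y. partial_theta_mellin (\<i> * \<alpha> / 2) (y\<^sup>2) / 2) \<longlongrightarrow> 0 / 2) (at_right 0)"
    by (intro tendsto_divide filterlim_compose[OF partial_theta_mellin_at_0] tendsto_const; real_asymp?) auto
  thus "(weighted_integral \<alpha> \<longlongrightarrow> 0) (at_right 0)"
    by (rule Lim_transform_eventually[THEN tendsto_eq_rhs])
       (auto simp: weighted_integral_eq intro!: eventually_at_rightI[of 0 1])
  have "((\<lambda>y. partial_theta_mellin (\<i> * \<alpha> / 2) (y\<^sup>2) / 2) \<longlongrightarrow> theta_mellin (\<i> * \<alpha> / 2) / 2) at_top"
    by (intro tendsto_divide filterlim_compose[OF partial_theta_mellin_at_top] tendsto_const; real_asymp?) auto
  thus "(weighted_integral \<alpha> \<longlongrightarrow> riemann_Xi \<alpha> / 2) at_top"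
    unfolding riemann_Xi_eq
    by (rule Lim_transform_eventually)
       (auto simp: weighted_integral_eq intro!: eventually_mono[OF eventually_gt_at_top[of 0]])
qed

text \<open>
  The logarithmic derivative of Theta_profile enters with a minus sign, because phi00 is minus its logarithm. The
  right-hand side is Theta_profile times the Dtimes-derivative of f / Theta_profile.
\<close>
lemma Lop_phi00:
  assumes t: "t > 0" and f: "(f has_vector_derivative f') (at t)"
    and D: "(Theta_profile has_real_derivative D) (at t)"
  shows "Lop phi00 f t = of_real t / \<i> * (f' - f t * of_real (D / Theta_profile t))"
proof -
  have "((\<lambda>s. - ln (Theta_profile s)) has_real_derivative - (D / Theta_profile t)) (at t)"
    using D Theta_profile_pos[OF t] by (auto intro!: derivative_eq_intros)
  hence "((\<lambda>s. complex_of_real (- ln (Theta_profile s))) has_vector_derivative of_real (- (D / Theta_profile t))) (at t)"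
    by (intro has_vector_derivative_of_real)
       (simp add: has_real_derivative_iff_has_vector_derivative)
  hence "(phi00 has_vector_derivative of_real (- (D / Theta_profile t))) (at t)"
    by (rule has_vector_derivative_transform_within_open[where S = "{0<..}"])
       (use t in \<open>auto simp: phi00_def Theta00_profile Theta_profile_pos Ln_of_real simp del: of_real_power\<close>)
  thus ?thesis
    using f by (simp add: Lop_def Dtimes_def vector_derivative_at algebra_simps)
qed

lemma of_real_powr_has_vector_derivative:
  assumes "t > 0"
  shows "((\<lambda>t. complex_of_real t powr z) has_vector_derivative z / of_real t * of_real t powr z) (at t)"
proof -
  have "((\<lambda>t. exp (z * complex_of_real (ln t))) has_vector_derivative z / of_real t * exp (z * of_real (ln t))) (at t)"
  proof -
    have "((\<lambda>t. complex_of_real (ln t)) has_vector_derivative of_real (1 / t)) (at t)"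
      using assms by (intro has_vector_derivative_of_real)
        (auto intro!: derivative_eq_intros simp flip: has_real_derivative_iff_has_vector_derivative)
    hence "((\<lambda>t. z * complex_of_real (ln t)) has_vector_derivative z * of_real (1 / t)) (at t)"
      by (rule has_vector_derivative_mult_right)
    hence "(exp \<circ> (\<lambda>t. z * complex_of_real (ln t)) has_vector_derivative
        (z * of_real (1 / t)) * exp (z * of_real (ln t))) (at t)"
      by (rule field_vector_diff_chain_at) (rule DERIV_exp)
    thus ?thesis by (simp add: o_def)
  qed
  hence "((\<lambda>t. complex_of_real t powr z) has_vector_derivative z / of_real t * exp (z * of_real (ln t))) (at t)"
    by (rule has_vector_derivative_transform_within_open[where S = "{0<..}"])
       (use assms in \<open>auto simp: of_real_powr_conv_exp\<close>)
  thus ?thesis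
    unfolding of_real_powr_conv_exp[OF assms] .
qed

lemma of_real_powr_minus_cancel:
  assumes "t > 0"
  shows "complex_of_real t powr (- z) * of_real t powr z = 1"
  using assms by (simp add: powr_minus)

lemma norm_weighted:
  assumes "t > 0"
  shows "norm (of_real (t powr (- Im \<alpha>)) * u) = norm (of_real t powr (\<i> * \<alpha>) * u)"
  using assms by (simp add: norm_mult norm_of_real_powr)

text \<open>
  The real weight t^(- Im \<alpha>) is the absolute value of the integrating factor t^(i \<alpha>).
\<close>
lemma weighted_limit_iff:
  assumes "eventually (\<lambda>t. t > 0) F"
  shows "((\<lambda>t. of_real (t powr (- Im \<alpha>)) * u t) \<longlongrightarrow> 0) F \<longleftrightarrow> ((\<lambda>t. of_real t powr (\<i> * \<alpha>) * u t) \<longlongrightarrow> 0) F"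
proof -
  have "((\<lambda>t. norm (of_real (t powr (- Im \<alpha>)) * u t)) \<longlongrightarrow> 0) F \<longleftrightarrow>
      ((\<lambda>t. norm (of_real t powr (\<i> * \<alpha>) * u t)) \<longlongrightarrow> 0) F"
    by (intro tendsto_cong eventually_mono[OF assms] norm_weighted)
  thus ?thesis by (simp only: tendsto_norm_zero_iff)
qed

text \<open>
  Two integrations. The equation says that v / Theta_profile has derivative 0, where v = Dtimes u + \<alpha> u; this
  gives the constant c. Multiplying the resulting first-order equation by t^(i \<alpha>) turns it into an equation
  for the derivative of w = t^(i \<alpha>) u and gives the constant K. The boundary conditions at 0 and at
  infinity give K = 0 and c \<Xi>(\<alpha>) = 0.
\<close>
lemma bvp_solution_imp:
  assumes sol: "bvp_solution \<alpha> u"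
  shows "\<exists>C. (\<forall>t>0. u t = C * u_sol \<alpha> t) \<and> C * riemann_Xi \<alpha> = 0"
proof -
  let ?Q = Theta_profile
  have u_deriv: "(u has_vector_derivative vector_derivative u (at t)) (at t)"
    and du_diff: "(\<lambda>s. vector_derivative u (at s)) differentiable (at t)" if "t > 0" for t
    using sol that by (auto simp: bvp_solution_def twice_differentiable_pos_def vector_derivative_works)
  define v where "v = (\<lambda>t. Dtimes u t + \<alpha> * u t)"
  obtain c where c: "\<And>t. t \<in> {0<..} \<Longrightarrow> v t / of_real (?Q t) = c"
  proof (rule has_vector_derivative_zero_constant[of "{0<..}" "\<lambda>t. v t / of_real (?Q t)"])
    fix t :: real assume "t \<in> {0<..}"
    hence t: "t > 0" by simp
    obtain D where D: "(?Q has_real_derivative D) (at t)"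
      using Theta_profile_has_derivative[OF t] by blast
    have Q: "?Q t \<noteq> 0" using Theta_profile_pos[OF t] by simp
    obtain d where "((\<lambda>s. vector_derivative u (at s)) has_vector_derivative d) (at t)"
      using du_diff[OF t] vector_derivative_works by blast
    hence "((\<lambda>s. of_real s / \<i> * vector_derivative u (at s)) has_vector_derivative
        (of_real t / \<i> * d + 1 / \<i> * vector_derivative u (at t))) (at t)"
      by (intro has_vector_derivative_mult) (auto intro!: derivative_eq_intros)
    then obtain d' where d': "(Dtimes u has_vector_derivative d') (at t)"
      unfolding Dtimes_def by blast
    let ?v' = "d' + \<alpha> * vector_derivative u (at t)"
    have v': "(v has_vector_derivative ?v') (at t)"
      unfolding v_def by (auto intro!: derivative_eq_intros d' u_deriv t)
    have "0 = Lop phi00 (Dtimes u) t + \<alpha> * Lop phi00 u t"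
      using sol t by (simp add: bvp_solution_def)
    also have "\<dots> = of_real t / \<i> * (?v' - v t * of_real (D / ?Q t))"
      unfolding Lop_phi00[OF t d' D] Lop_phi00[OF t u_deriv[OF t] D] v_def by (simp add: algebra_simps)
    finally have ode: "?v' = v t * of_real (D / ?Q t)"
      using t by simp
    have "((\<lambda>s. 1 / ?Q s) has_real_derivative - D / (?Q t)\<^sup>2) (at t)"
      using D Q by (auto intro!: derivative_eq_intros simp: power2_eq_square)
    hence "((\<lambda>s. complex_of_real (1 / ?Q s)) has_vector_derivative of_real (- D / (?Q t)\<^sup>2)) (at t)"
      by (intro has_vector_derivative_of_real) (simp add: has_real_derivative_iff_has_vector_derivative)
    hence "((\<lambda>s. v s * of_real (1 / ?Q s)) has_vector_derivative
        (v t * of_real (- D / (?Q t)\<^sup>2) + ?v' * of_real (1 / ?Q t))) (at t)"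
      by (intro has_vector_derivative_mult v')
    also have "v t * of_real (- D / (?Q t)\<^sup>2) + ?v' * of_real (1 / ?Q t) = 0"
      unfolding ode using Q by (simp add: power2_eq_square)
    finally show "((\<lambda>t. v t / of_real (?Q t)) has_vector_derivative 0) (at t within {0<..})"
      by (simp add: divide_inverse has_vector_derivative_at_within)
  qed auto
  have v_eq: "v t = c * of_real (?Q t)" if "t > 0" for t
    using c[of t] Theta_profile_pos[OF that] that by (simp add: field_simps)
  define w where "w = (\<lambda>t. of_real t powr (\<i> * \<alpha>) * u t)"
  obtain K where K: "\<And>t. t \<in> {0<..} \<Longrightarrow> w t - \<i> * c * weighted_integral \<alpha> t = K"
  proof (rule has_vector_derivative_zero_constant[of "{0<..}" "\<lambda>t. w t - \<i> * c * weighted_integral \<alpha> t"])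
    fix t :: real assume "t \<in> {0<..}"
    hence t: "t > 0" by simp
    let ?p = "complex_of_real t powr (\<i> * \<alpha>)" and ?u' = "vector_derivative u (at t)"
    have "(w has_vector_derivative (?p * ?u' + \<i> * \<alpha> / of_real t * ?p * u t)) (at t)"
      unfolding w_def by (intro has_vector_derivative_mult u_deriv of_real_powr_has_vector_derivative t)
    also have "?p * ?u' + \<i> * \<alpha> / of_real t * ?p * u t = \<i> / of_real t * ?p * v t"
      using t by (simp add: v_def Dtimes_def field_simps)
    finally have "((\<lambda>t. w t - \<i> * c * weighted_integral \<alpha> t) has_vector_derivative
        (\<i> / of_real t * ?p * v t - \<i> * c * (?p * of_real (?Q t) / of_real t))) (at t)"
      by (intro has_vector_derivative_diff has_vector_derivative_mult_right has_vector_derivative_weighted_integral t)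
    also have "\<i> / of_real t * ?p * v t - \<i> * c * (?p * of_real (?Q t) / of_real t) = 0"
      unfolding v_eq[OF t] by simp
    finally show "((\<lambda>t. w t - \<i> * c * weighted_integral \<alpha> t) has_vector_derivative 0) (at t within {0<..})"
      by (rule has_vector_derivative_at_within)
  qed auto
  have w_eq: "w t = K + \<i> * c * weighted_integral \<alpha> t" if "t > 0" for t
    using K[of t] that by (simp add: algebra_simps)
  have pos_0: "eventually (\<lambda>t::real. t > 0) (at_right 0)" by (rule eventually_at_right_less)
  have pos_top: "eventually (\<lambda>t::real. t > 0) at_top" by (rule eventually_gt_at_top)
  have w_0: "(w \<longlongrightarrow> 0) (at_right 0)" and w_top: "(w \<longlongrightarrow> 0) at_top"
    using sol unfolding bvp_solution_def weighted_limit_iff[OF pos_0] weighted_limit_iff[OF pos_top] w_def by auto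
  have "((\<lambda>t. K + \<i> * c * weighted_integral \<alpha> t) \<longlongrightarrow> K + \<i> * c * 0) (at_right 0)"
    by (intro tendsto_intros weighted_integral_at_0)
  moreover have "((\<lambda>t. K + \<i> * c * weighted_integral \<alpha> t) \<longlongrightarrow> 0) (at_right 0)"
    by (rule Lim_transform_eventually[OF w_0]) (rule eventually_mono[OF pos_0 w_eq])
  ultimately have K0: "K = 0"
    using tendsto_unique[OF trivial_limit_at_right_real] by fastforce
  have "((\<lambda>t. \<i> * c * weighted_integral \<alpha> t) \<longlongrightarrow> \<i> * c * (riemann_Xi \<alpha> / 2)) at_top"
    by (intro tendsto_intros weighted_integral_at_top)
  moreover have "((\<lambda>t. \<i> * c * weighted_integral \<alpha> t) \<longlongrightarrow> 0) at_top"
    by (rule Lim_transform_eventually[OF w_top]) (rule eventually_mono[OF pos_top], simp add: w_eq K0)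
  ultimately have "\<i> * c * (riemann_Xi \<alpha> / 2) = 0"
    using tendsto_unique[OF trivial_limit_at_top_linorder] by blast
  hence "\<i> * c * riemann_Xi \<alpha> = 0" by simp
  moreover have "u t = \<i> * c * u_sol \<alpha> t" if t: "t > 0" for t
  proof -
    have "u t = of_real t powr (- (\<i> * \<alpha>)) * w t"
      using of_real_powr_minus_cancel[OF t, of "\<i> * \<alpha>"] by (simp add: w_def flip: mult.assoc)
    thus ?thesis unfolding w_eq[OF t] K0 by (simp add: u_sol_def weighted_integral_def)
  qed
  ultimately show ?thesis by blast
qed

text \<open>
  A multiple u of u_sol satisfies Dtimes u = - \<alpha> u + (C / i) Theta_profile, so that Dtimes u + \<alpha> u is a
  multiple of Theta_profile and is annihilated by Lop phi00. The boundary value at infinity is a multiple of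
  C \<Xi>(\<alpha>), which vanishes by assumption.
\<close>
lemma imp_bvp_solution:
  assumes u: "\<And>t. t > 0 \<Longrightarrow> u t = C * u_sol \<alpha> t" and C: "C * riemann_Xi \<alpha> = 0"
  shows "bvp_solution \<alpha> u"
proof -
  let ?Q = Theta_profile
  have u_eq: "u t = C * (of_real t powr (- (\<i> * \<alpha>)) * weighted_integral \<alpha> t)" if "t > 0" for t
    using u[OF that] by (simp add: u_sol_def weighted_integral_def)
  define u1 where "u1 = (\<lambda>t. (- \<i> * \<alpha> * u t + C * of_real (?Q t)) / of_real t)"
  have u1: "(u has_vector_derivative u1 t) (at t)" if t: "t > 0" for t
  proof -
    let ?p = "complex_of_real t powr (- (\<i> * \<alpha>))" and ?q = "complex_of_real t powr (\<i> * \<alpha>)"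
    have "((\<lambda>t. C * (of_real t powr (- (\<i> * \<alpha>)) * weighted_integral \<alpha> t)) has_vector_derivative
        C * (?p * (?q * of_real (?Q t) / of_real t) + (- (\<i> * \<alpha>)) / of_real t * ?p * weighted_integral \<alpha> t)) (at t)"
      by (intro has_vector_derivative_mult_right has_vector_derivative_mult
          of_real_powr_has_vector_derivative has_vector_derivative_weighted_integral t)
    also have "C * (?p * (?q * of_real (?Q t) / of_real t) + (- (\<i> * \<alpha>)) / of_real t * ?p * weighted_integral \<alpha> t)
        = C * ((?p * ?q) * of_real (?Q t) / of_real t) - \<i> * \<alpha> / of_real t * u t"
      unfolding u_eq[OF t] by (simp add: algebra_simps)
    also have "\<dots> = u1 t"
      unfolding of_real_powr_minus_cancel[OF t] u1_def by (simp add: diff_divide_distrib)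
    finally show ?thesis
      by (rule has_vector_derivative_transform_within_open[where S = "{0<..}"]) (use t u_eq in auto)
  qed
  have u_deriv: "vector_derivative u (at t) = u1 t" if "t > 0" for t
    using vector_derivative_at[OF u1[OF that]] .
  have Q_deriv: "((\<lambda>s. complex_of_real (?Q s)) has_vector_derivative of_real D) (at t)"
    if "(?Q has_real_derivative D) (at t)" for D t
    using that by (intro has_vector_derivative_of_real) (simp add: has_real_derivative_iff_has_vector_derivative)
  have twice: "twice_differentiable_pos u"
    unfolding twice_differentiable_pos_def
  proof (intro allI impI conjI)
    fix t :: real assume t: "t > 0"
    show "u differentiable (at t)"
      using u1[OF t] by (rule differentiableI_vector)
    obtain D where D: "(?Q has_real_derivative D) (at t)"
      using Theta_profile_has_derivative[OF t] by blast
    have diff: "(\<lambda>s. complex_of_real (?Q s)) differentiable (at t)"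
      using Q_deriv[OF D] by (rule differentiableI_vector)
    have "(\<lambda>s. (- \<i> * \<alpha> * u s + C * of_real (?Q s)) / complex_of_real s) differentiable (at t)"
      using t diff \<open>u differentiable (at t)\<close>
      by (intro differentiable_divide differentiable_add differentiable_mult differentiable_const)
         (auto intro!: differentiableI_vector[of _ 1] derivative_eq_intros)
    hence "u1 differentiable (at t)" unfolding u1_def .
    then obtain d where "(u1 has_vector_derivative d) (at t)"
      using vector_derivative_works by blast
    hence "((\<lambda>s. vector_derivative u (at s)) has_vector_derivative d) (at t)"
      by (rule has_vector_derivative_transform_within_open[where S = "{0<..}"]) (use t u_deriv in auto)
    thus "(\<lambda>s. vector_derivative u (at s)) differentiable (at t)"
      by (rule differentiableI_vector)
  qed
  have ode: "Lop phi00 (Dtimes u) t + \<alpha> * Lop phi00 u t = 0" if t: "t > 0" for t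
  proof -
    obtain D where D: "(?Q has_real_derivative D) (at t)"
      using Theta_profile_has_derivative[OF t] by blast
    have "((\<lambda>s. - \<alpha> * u s + C / \<i> * of_real (?Q s)) has_vector_derivative
        (- \<alpha> * u1 t + C / \<i> * of_real D)) (at t)"
      by (intro has_vector_derivative_add has_vector_derivative_mult_right u1 t Q_deriv D)
    hence dD: "(Dtimes u has_vector_derivative (- \<alpha> * u1 t + C / \<i> * of_real D)) (at t)"
    proof (rule has_vector_derivative_transform_within_open[where S = "{0<..}"])
      show "- \<alpha> * u s + C / \<i> * of_real (?Q s) = Dtimes u s" if "s \<in> {0<..}" for s
        using that by (simp add: Dtimes_def u_deriv u1_def field_simps)
    qed (use t in auto)
    have "Lop phi00 (Dtimes u) t + \<alpha> * Lop phi00 u t =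
        of_real t / \<i> * (C / \<i> * of_real D - (Dtimes u t + \<alpha> * u t) * of_real (D / ?Q t))"
      unfolding Lop_phi00[OF t dD D] Lop_phi00[OF t u1[OF t] D] by (simp add: algebra_simps)
    also have "Dtimes u t + \<alpha> * u t = C / \<i> * of_real (?Q t)"
      using t by (simp add: Dtimes_def u_deriv u1_def field_simps)
    finally show ?thesis using Theta_profile_pos[OF t] by simp
  qed
  have pos_0: "eventually (\<lambda>t::real. t > 0) (at_right 0)" by (rule eventually_at_right_less)
  have pos_top: "eventually (\<lambda>t::real. t > 0) at_top" by (rule eventually_gt_at_top)
  have w_eq: "C * weighted_integral \<alpha> t = of_real t powr (\<i> * \<alpha>) * u t" if t: "t > 0" for t
    using of_real_powr_minus_cancel[OF t, of "\<i> * \<alpha>"] unfolding u_eq[OF t]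
    by (metis mult.assoc mult.commute mult.left_neutral)
  have "((\<lambda>t. C * weighted_integral \<alpha> t) \<longlongrightarrow> C * 0) (at_right 0)"
    by (intro tendsto_intros weighted_integral_at_0)
  hence "((\<lambda>t. of_real t powr (\<i> * \<alpha>) * u t) \<longlongrightarrow> C * 0) (at_right 0)"
    by (rule Lim_transform_eventually) (rule eventually_mono[OF pos_0 w_eq])
  moreover have "((\<lambda>t. C * weighted_integral \<alpha> t) \<longlongrightarrow> C * (riemann_Xi \<alpha> / 2)) at_top"
    by (intro tendsto_intros weighted_integral_at_top)
  hence "((\<lambda>t. of_real t powr (\<i> * \<alpha>) * u t) \<longlongrightarrow> C * (riemann_Xi \<alpha> / 2)) at_top"
    by (rule Lim_transform_eventually) (rule eventually_mono[OF pos_top w_eq])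
  ultimately show ?thesis
    using twice ode C unfolding bvp_solution_def weighted_limit_iff[OF pos_0] weighted_limit_iff[OF pos_top] by auto
qed

theorem theorem3p3p3:
  fixes \<alpha> :: complex
  shows "(riemann_Xi \<alpha> \<noteq> 0 \<longrightarrow>
            (\<forall>u. bvp_solution \<alpha> u \<longleftrightarrow> (\<forall>t>0. u t = 0))) \<and>
         (riemann_Xi \<alpha> = 0 \<longrightarrow>
            (\<forall>u. bvp_solution \<alpha> u \<longleftrightarrow> (\<exists>C. \<forall>t>0. u t = C * u_sol \<alpha> t)))"
proof -
  have "bvp_solution \<alpha> u \<longleftrightarrow> (\<exists>C. (\<forall>t>0. u t = C * u_sol \<alpha> t) \<and> C * riemann_Xi \<alpha> = 0)" for u
    using bvp_solution_imp imp_bvp_solution by blast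
  thus ?thesis by auto
qed

end
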